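(* Let $\mathcal N_1,\mathcal N_2$ be nests acting on Hilbert spaces $H_1,H_2$ and let $\theta:\mathcal N_1\to\mathcal N_2$ be a nest isomorphism. Let $X=\mathrm{Op}(\theta)$, $Y=\mathrm{Op}(\theta^{-1})$ and let $X_0,Y_0$ be their subspaces of compact operators. Then there exists a net $(f_\lambda)_{\lambda\in\Lambda}$ of finite rank contractions converging in the strong operator topology to the identity operator $I_{H_1}$ such that, for every $\lambda\in\Lambda$, $f_\lambda=\|\cdot\|\text{-}\lim_{i\in\mathbb N}v_i^\lambda u_i^\lambda$ for some sequences $(v_i^\lambda)_{i\in\mathbb N}\subset \mathrm{Ball}(R_\infty^{fin}(Y_0))$ and $(u_i^\lambda)_{i\in\mathbb N}\subset \mathrm{Ball}(C_\infty^{fin}(X_0))$.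
   Context: A nest on a Hilbert space $H$ is a totally ordered set of orthogonal projections of $H$ containing $0$ and $I$ and closed under arbitrary intersections and closed spans. A nest isomorphism is an order preserving bijection between two nests. $N^\perp=I-N$. $\mathrm{Op}(\theta)=\{x\in B(H_1,H_2):\theta(N)^\perp xN=0\ \forall N\in\mathcal N_1\}$ and similarly $\mathrm{Op}(\theta^{-1})=\{y\in B(H_2,H_1): N^\perp y\,\theta(N)=0\ \forall N\in\mathcal N_1\}$. For a subspace $Z\subset B(H,K)$, $R_\infty^{fin}(Z)$ is the space of row operators $(z_1,z_2,\dots):H^\infty\to K$ and $C_\infty^{fin}(Z)$ the space of column operators $(z_1,z_2,\dots)^T:H\to K^\infty$, with all $z_i\in Z$ and only finitely many $z_i$ nonzero; both carry the operator norm. $\mathrm{Ball}$ denotes the (closed) unit ball. The product of a row $v\in R_\infty^{fin}(Y_0)$ and a column $u\in C_\infty^{fin}(X_0)$ is $vu=\sum_k v_ku_k\in B(H_1)$. *)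

theory Defs
  imports "HOL-Analysis.Analysis"
begin

section \<open>Complex Hilbert spaces\<close>

text \<open>
  A complex Hilbert space is presented as a complete real inner product space with a compatible
  complex structure; the real inner product is the real part of the complex one, so that the norm,
  completeness and the topology are those of the library classes and
  \<open>norm x = sqrt (Re (cinner x x))\<close>. The complex inner product is linear in its first argument.
\<close>

class complex_hilbert_space = real_inner + complete_space +
  fixes scaleC :: "complex \<Rightarrow> 'a \<Rightarrow> 'a"  (infixr \<open>*\<^sub>C\<close> 75)
    and cinner :: "'a \<Rightarrow> 'a \<Rightarrow> complex"
  assumes scaleC_add_right: "c *\<^sub>C (x + y) = c *\<^sub>C x + c *\<^sub>C y"
    and scaleC_add_left: "(c + d) *\<^sub>C x = c *\<^sub>C x + d *\<^sub>C x"
    and scaleC_scaleC: "c *\<^sub>C d *\<^sub>C x = (c * d) *\<^sub>C x"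
    and scaleC_of_real: "complex_of_real r *\<^sub>C x = r *\<^sub>R x"
    and cinner_commute: "cinner x y = cnj (cinner y x)"
    and cinner_add_left: "cinner (x + y) z = cinner x z + cinner y z"
    and cinner_scaleC_left: "cinner (c *\<^sub>C x) y = c * cinner x y"
    and inner_eq_Re_cinner: "inner x y = Re (cinner x y)"

instantiation complex :: complex_hilbert_space
begin

definition scaleC_complex :: "complex \<Rightarrow> complex \<Rightarrow> complex"
  where "scaleC_complex c x = c * x"

definition cinner_complex :: "complex \<Rightarrow> complex \<Rightarrow> complex"
  where "cinner_complex x y = x * cnj y"

instance
  by standard
    (auto simp: scaleC_complex_def cinner_complex_def algebra_simps inner_complex_def
       scaleR_conv_of_real)

end

definition csubspace :: "'a::complex_hilbert_space set \<Rightarrow> bool"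
  where "csubspace S \<longleftrightarrow>
    0 \<in> S \<and> (\<forall>x\<in>S. \<forall>y\<in>S. x + y \<in> S) \<and> (\<forall>c. \<forall>x\<in>S. c *\<^sub>C x \<in> S)"

definition cspan :: "'a::complex_hilbert_space set \<Rightarrow> 'a set"
  where "cspan S = csubspace hull S"


section \<open>Bounded operators\<close>

text \<open>
  The library type of bounded linear maps consists of the real-linear ones; \<open>B(H,K)\<close> is the subset
  of the complex-linear ones. The norm of that type is the operator norm.
\<close>

definition clinear_ops ::
    "('a::complex_hilbert_space \<Rightarrow>\<^sub>L 'b::complex_hilbert_space) set"
  where "clinear_ops = {T. \<forall>c x. blinfun_apply T (c *\<^sub>C x) = c *\<^sub>C blinfun_apply T x}"

definition compact_operator ::
    "('a::complex_hilbert_space \<Rightarrow>\<^sub>L 'b::complex_hilbert_space) \<Rightarrow> bool"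
  where "compact_operator T \<longleftrightarrow> compact (closure (blinfun_apply T ` cball 0 1))"

definition finite_rank ::
    "('a::complex_hilbert_space \<Rightarrow>\<^sub>L 'b::complex_hilbert_space) \<Rightarrow> bool"
  where "finite_rank T \<longleftrightarrow> (\<exists>B. finite B \<and> range (blinfun_apply T) \<subseteq> cspan B)"

definition orthogonal_projection ::
    "('a::complex_hilbert_space \<Rightarrow>\<^sub>L 'a) \<Rightarrow> bool"
  where "orthogonal_projection P \<longleftrightarrow>
    P \<in> clinear_ops \<and> P o\<^sub>L P = P \<and>
    (\<forall>x y. cinner (blinfun_apply P x) y = cinner x (blinfun_apply P y))"

definition proj_le ::
    "('a::complex_hilbert_space \<Rightarrow>\<^sub>L 'a) \<Rightarrow> ('a \<Rightarrow>\<^sub>L 'a) \<Rightarrow> bool"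
  where "proj_le P Q \<longleftrightarrow> range (blinfun_apply P) \<subseteq> range (blinfun_apply Q)"


section \<open>Nests\<close>

text \<open>
  Intersections and closed spans of projections are those of their ranges.
\<close>

definition nest :: "('a::complex_hilbert_space \<Rightarrow>\<^sub>L 'a) set \<Rightarrow> bool"
  where "nest \<N> \<longleftrightarrow>
    (\<forall>P\<in>\<N>. orthogonal_projection P) \<and>
    (\<forall>P\<in>\<N>. \<forall>Q\<in>\<N>. proj_le P Q \<or> proj_le Q P) \<and>
    0 \<in> \<N> \<and> id_blinfun \<in> \<N> \<and>
    (\<forall>S\<subseteq>\<N>. \<exists>P\<in>\<N>. range (blinfun_apply P) = (\<Inter>Q\<in>S. range (blinfun_apply Q))) \<and>
    (\<forall>S\<subseteq>\<N>. \<exists>P\<in>\<N>. range (blinfun_apply P) = closure (cspan (\<Union>Q\<in>S. range (blinfun_apply Q))))"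

definition nest_isomorphism ::
    "('a::complex_hilbert_space \<Rightarrow>\<^sub>L 'a) set \<Rightarrow> ('b::complex_hilbert_space \<Rightarrow>\<^sub>L 'b) set \<Rightarrow>
     (('a \<Rightarrow>\<^sub>L 'a) \<Rightarrow> ('b \<Rightarrow>\<^sub>L 'b)) \<Rightarrow> bool"
  where "nest_isomorphism \<N>\<^sub>1 \<N>\<^sub>2 \<theta> \<longleftrightarrow>
    bij_betw \<theta> \<N>\<^sub>1 \<N>\<^sub>2 \<and> monotone_on \<N>\<^sub>1 proj_le proj_le \<theta>"

text \<open>
  \<open>Op_nest \<N>\<^sub>1 \<theta>\<close> is \<open>Op(\<theta>)\<close>; \<open>Op_nest_inv \<N>\<^sub>1 \<theta>\<close> is
  \<open>Op(\<theta>\<^sup>-\<^sup>1)\<close>, where the members of the second nest are written as \<open>\<theta> N\<close>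
  with \<open>N \<in> \<N>\<^sub>1\<close>.
\<close>

definition Op_nest ::
    "('a::complex_hilbert_space \<Rightarrow>\<^sub>L 'a) set \<Rightarrow>
     (('a \<Rightarrow>\<^sub>L 'a) \<Rightarrow> ('b::complex_hilbert_space \<Rightarrow>\<^sub>L 'b)) \<Rightarrow> ('a \<Rightarrow>\<^sub>L 'b) set"
  where "Op_nest \<N>\<^sub>1 \<theta> =
    {x \<in> clinear_ops. \<forall>N\<in>\<N>\<^sub>1. (id_blinfun - \<theta> N) o\<^sub>L x o\<^sub>L N = 0}"

definition Op_nest_inv ::
    "('a::complex_hilbert_space \<Rightarrow>\<^sub>L 'a) set \<Rightarrow>
     (('a \<Rightarrow>\<^sub>L 'a) \<Rightarrow> ('b::complex_hilbert_space \<Rightarrow>\<^sub>L 'b)) \<Rightarrow> ('b \<Rightarrow>\<^sub>L 'a) set"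
  where "Op_nest_inv \<N>\<^sub>1 \<theta> =
    {y \<in> clinear_ops. \<forall>N\<in>\<N>\<^sub>1. (id_blinfun - N) o\<^sub>L y o\<^sub>L \<theta> N = 0}"

definition compact_part ::
    "('a::complex_hilbert_space \<Rightarrow>\<^sub>L 'b::complex_hilbert_space) set \<Rightarrow> ('a \<Rightarrow>\<^sub>L 'b) set"
  where "compact_part Z = {z \<in> Z. compact_operator z}"


section \<open>Finitely supported rows and columns\<close>

text \<open>
  \<open>H\<^sup>\<infinity>\<close> is the Hilbert space of square-summable sequences in \<open>H\<close>, with norm
  \<open>l2_norm\<close>.
\<close>

definition l2_seqs :: "(nat \<Rightarrow> 'a::complex_hilbert_space) set"
  where "l2_seqs = {h. summable (\<lambda>k. (norm (h k))\<^sup>2)}"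

definition l2_norm :: "(nat \<Rightarrow> 'a::complex_hilbert_space) \<Rightarrow> real"
  where "l2_norm h = sqrt (\<Sum>k. (norm (h k))\<^sup>2)"

definition fin_supp_seqs ::
    "('a::complex_hilbert_space \<Rightarrow>\<^sub>L 'b::complex_hilbert_space) set \<Rightarrow> (nat \<Rightarrow> 'a \<Rightarrow>\<^sub>L 'b) set"
  where "fin_supp_seqs Z = {z. (\<forall>k. z k \<in> Z) \<and> finite {k. z k \<noteq> 0}}"

text \<open>
  A finitely supported sequence \<open>z\<close> of operators from \<open>H\<close> to \<open>K\<close> acts as a row from
  \<open>H\<^sup>\<infinity>\<close> to \<open>K\<close> and as a column from \<open>H\<close> to \<open>K\<^sup>\<infinity>\<close>. The operator norms below
  are suprema of sets that are bounded above because \<open>z\<close> has finite support.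
\<close>

definition row_apply ::
    "(nat \<Rightarrow> 'a::complex_hilbert_space \<Rightarrow>\<^sub>L 'b::complex_hilbert_space) \<Rightarrow> (nat \<Rightarrow> 'a) \<Rightarrow> 'b"
  where "row_apply z h = (\<Sum>k | z k \<noteq> 0. blinfun_apply (z k) (h k))"

definition col_apply ::
    "(nat \<Rightarrow> 'a::complex_hilbert_space \<Rightarrow>\<^sub>L 'b::complex_hilbert_space) \<Rightarrow> 'a \<Rightarrow> (nat \<Rightarrow> 'b)"
  where "col_apply z x = (\<lambda>k. blinfun_apply (z k) x)"

definition row_norm ::
    "(nat \<Rightarrow> 'a::complex_hilbert_space \<Rightarrow>\<^sub>L 'b::complex_hilbert_space) \<Rightarrow> real"
  where "row_norm z = (SUP h\<in>{h \<in> l2_seqs. l2_norm h \<le> 1}. norm (row_apply z h))"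

definition col_norm ::
    "(nat \<Rightarrow> 'a::complex_hilbert_space \<Rightarrow>\<^sub>L 'b::complex_hilbert_space) \<Rightarrow> real"
  where "col_norm z = (SUP x\<in>{x. norm x \<le> 1}. l2_norm (col_apply z x))"

definition row_ball ::
    "('a::complex_hilbert_space \<Rightarrow>\<^sub>L 'b::complex_hilbert_space) set \<Rightarrow> (nat \<Rightarrow> 'a \<Rightarrow>\<^sub>L 'b) set"
  where "row_ball Z = {z \<in> fin_supp_seqs Z. row_norm z \<le> 1}"

definition col_ball ::
    "('a::complex_hilbert_space \<Rightarrow>\<^sub>L 'b::complex_hilbert_space) set \<Rightarrow> (nat \<Rightarrow> 'a \<Rightarrow>\<^sub>L 'b) set"
  where "col_ball Z = {z \<in> fin_supp_seqs Z. col_norm z \<le> 1}"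

definition row_col_prod ::
    "(nat \<Rightarrow> 'b::complex_hilbert_space \<Rightarrow>\<^sub>L 'c::complex_hilbert_space) \<Rightarrow>
     (nat \<Rightarrow> 'a::complex_hilbert_space \<Rightarrow>\<^sub>L 'b) \<Rightarrow> ('a \<Rightarrow>\<^sub>L 'c)"
  where "row_col_prod v u = (\<Sum>k | v k \<noteq> 0. v k o\<^sub>L u k)"


section \<open>Nets\<close>

definition directed_preorder :: "'i set \<Rightarrow> 'i rel \<Rightarrow> bool"
  where "directed_preorder \<Lambda> r \<longleftrightarrow>
    \<Lambda> \<noteq> {} \<and> preorder_on \<Lambda> r \<and>
    (\<forall>a\<in>\<Lambda>. \<forall>b\<in>\<Lambda>. \<exists>c\<in>\<Lambda>. (a, c) \<in> r \<and> (b, c) \<in> r)"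

text \<open>
  The filter generated by the tails of a directed set; convergence of a net indexed by
  \<open>\<Lambda>\<close> is convergence along this filter. For nets of operators on \<open>H\<close> that converge
  strongly, index sets consisting of subsets of \<open>H\<close> are general enough: the limit can always be
  attained along the finite subsets of \<open>H\<close> by suitably chosen members of the given net.
\<close>

definition net_filter :: "'i set \<Rightarrow> 'i rel \<Rightarrow> 'i filter"
  where "net_filter \<Lambda> r = (INF a\<in>\<Lambda>. principal {b \<in> \<Lambda>. (a, b) \<in> r})"

end

theory Submission
  imports Defs
begin

text \<open>
  The approximants are finite sums \<open>f = \<Sum>\<^sub>k |a\<^sub>k\<rangle>\<langle>b\<^sub>k|\<close> with orthonormal \<open>a\<^sub>k\<close> and
  orthonormal \<open>b\<^sub>k\<close>, hence partial isometries of finite rank. Suppose that every summand factors as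
  \<open>|a\<^sub>k\<rangle>\<langle>y\<^sub>k| |y\<^sub>k\<rangle>\<langle>b\<^sub>k|\<close> with a unit vector \<open>y\<^sub>k\<close>, the first factor in
  \<open>Op(\<theta>\<^sup>-\<^sup>1)\<close> and the second in \<open>Op(\<theta>)\<close>. Then \<open>f = v u\<close> exactly, where the row \<open>v\<close> of the first
  factors is a contraction because the \<open>a\<^sub>k\<close> are orthonormal, and the column \<open>u\<close> of the second
  factors is one because the \<open>b\<^sub>k\<close> are (\<open>pair_isometry_factorization\<close>).

  The vector \<open>y\<close> is found between \<open>\<theta> P\<close> and \<open>\<theta> Q\<close> for some \<open>P < Q\<close> in the nest. It works if
  \<open>a\<close> lies in the range of \<open>P\<close> and \<open>b\<close> is orthogonal to that of \<open>Q\<close>, and, when nothing lies strictly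
  between \<open>P\<close> and \<open>Q\<close>, already if \<open>a\<close> lies in the range of \<open>Q\<close> and \<open>b\<close> is orthogonal to that
  of \<open>P\<close> (\<open>factorable_pair_factors\<close>). So it remains to approximate the identity by
  operators \<open>f\<close> that are block diagonal on gaps and strictly triangular elsewhere.

  To this end the space is split into orthogonal cyclic subspaces, each spanned by the vectors
  \<open>N z\<close> with \<open>N\<close> in the nest, where the unit vector \<open>z\<close> either lives in a single gap or has no
  component in any gap (\<open>exists_homogeneous_cyclic_decomposition\<close>). In the first case the
  subspace is a line and its projection is of the required form. In the second case
  \<open>N \<mapsto> norm (N z)\<close> has the intermediate value property, so that \<open>z\<close> can be cut along the nest
  into \<open>n\<close> pieces of equal norm; moving each piece to the place of the one two steps below it is
  strictly triangular and changes every \<open>N z\<close> by \<open>O(1 / sqrt n)\<close> only (\<open>gapless_shift\<close>). Sums over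
  finitely many cyclic subspaces then converge strongly to the identity.
\<close>

section \<open>Complex Hilbert spaces\<close>

lemma cinner_add_right: "cinner x (y + z) = cinner x y + cinner x z"
  by (metis cinner_add_left cinner_commute complex_cnj_add)

lemma cinner_scaleC_right: "cinner x (c *\<^sub>C y) = cnj c * cinner x y"
  by (metis cinner_commute cinner_scaleC_left complex_cnj_mult)

lemma cinner_zero_left [simp]: "cinner 0 x = 0"
  using cinner_add_left[of 0 0 x] by simp

lemma cinner_zero_right [simp]: "cinner x 0 = 0"
  using cinner_add_right[of x 0 0] by simp

lemma cinner_diff_left: "cinner (x - y) z = cinner x z - cinner y z"
  using cinner_add_left[of "x - y" y z] by (simp add: algebra_simps)

lemma cinner_diff_right: "cinner x (y - z) = cinner x y - cinner x z"
  using cinner_add_right[of x "y - z" z] by (simp add: algebra_simps)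

lemma cinner_sum_left: "cinner (sum f I) x = (\<Sum>i\<in>I. cinner (f i) x)"
  by (induction I rule: infinite_finite_induct) (auto simp: cinner_add_left)

lemma cinner_sum_right: "cinner x (sum f I) = (\<Sum>i\<in>I. cinner x (f i))"
  by (induction I rule: infinite_finite_induct) (auto simp: cinner_add_right)

lemma cinner_eq_zero_commute: "cinner x y = 0 \<longleftrightarrow> cinner y x = 0"
  by (metis cinner_commute complex_cnj_zero)

lemma scaleC_zero_left [simp]: "0 *\<^sub>C x = 0"
  using scaleC_add_left[of 0 0 x] by simp

lemma scaleC_zero_right [simp]: "c *\<^sub>C 0 = 0"
  using scaleC_add_right[of c 0 0] by simp

lemma scaleC_one [simp]: "1 *\<^sub>C x = x"
  using scaleC_of_real[of 1 x] by simp

lemma scaleC_sum_right: "c *\<^sub>C sum f I = (\<Sum>i\<in>I. c *\<^sub>C f i)"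
  by (induction I rule: infinite_finite_induct) (auto simp: scaleC_add_right)

lemma cinner_scaleR_left: "cinner (r *\<^sub>R x) y = of_real r * cinner x y"
  by (metis cinner_scaleC_left scaleC_of_real)

lemma cinner_scaleR_right: "cinner x (r *\<^sub>R y) = of_real r * cinner x y"
  by (metis cinner_scaleC_right scaleC_of_real complex_cnj_complex_of_real)

lemma cinner_self: "cinner x x = of_real ((norm x)\<^sup>2)"
proof -
  have "Im (cinner x x) = 0"
    using arg_cong[OF cinner_commute[of x x], of Im] by simp
  moreover have "Re (cinner x x) = (norm x)\<^sup>2"
    by (simp add: inner_eq_Re_cinner[symmetric] power2_norm_eq_inner)
  ultimately show ?thesis
    by (simp add: complex_eq_iff)
qed

lemma cinner_nondegenerate: "(\<And>y. cinner x y = 0) \<Longrightarrow> x = 0"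
  by (metis cinner_self norm_eq_zero of_real_eq_0_iff power_eq_0_iff)

lemma norm_scaleC: "norm (c *\<^sub>C x) = cmod c * norm x"
proof -
  have "cinner (c *\<^sub>C x) (c *\<^sub>C x) = (c * cnj c) * cinner x x"
    by (simp only: cinner_scaleC_left cinner_scaleC_right ac_simps)
  also have "\<dots> = of_real ((cmod c)\<^sup>2 * (norm x)\<^sup>2)"
    by (simp only: cinner_self complex_norm_square[symmetric] of_real_mult)
  finally have "complex_of_real ((norm (c *\<^sub>C x))\<^sup>2) = of_real ((cmod c * norm x)\<^sup>2)"
    by (simp only: cinner_self power_mult_distrib)
  then show ?thesis
    by (metis mult_nonneg_nonneg norm_ge_zero of_real_eq_iff power2_eq_imp_eq)
qed

text \<open>
  The phase of the complex inner product is absorbed by a unimodular factor, so that the real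
  Cauchy--Schwarz inequality applies.
\<close>
lemma cmod_cinner_le: "cmod (cinner x y) \<le> norm x * norm y"
proof (cases "cinner x y = 0")
  case False
  define u where "u = cnj (cinner x y) / of_real (cmod (cinner x y))"
  have u: "cmod u = 1" "u * cinner x y = of_real (cmod (cinner x y))"
    using False complex_norm_square[of "cinner x y"]
    by (simp_all add: u_def norm_divide power2_eq_square mult.commute eq_divide_eq divide_eq_eq)
  have "cmod (cinner x y) = Re (cinner (u *\<^sub>C x) y)"
    by (simp add: cinner_scaleC_left u)
  also have "\<dots> = inner (u *\<^sub>C x) y"
    by (simp add: inner_eq_Re_cinner)
  also have "\<dots> \<le> norm (u *\<^sub>C x) * norm y"
    by (rule norm_cauchy_schwarz)
  finally show ?thesis
    by (simp add: norm_scaleC u)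
qed simp

lemma bounded_linear_scaleC:
  "bounded_linear (\<lambda>x. c *\<^sub>C x :: 'a::complex_hilbert_space)"
proof (rule bounded_linear_intro[where K = "cmod c"])
  show "c *\<^sub>C r *\<^sub>R x = r *\<^sub>R c *\<^sub>C x" for r and x :: 'a
    by (simp add: scaleC_of_real[symmetric] scaleC_scaleC mult.commute)
qed (auto simp: scaleC_add_right norm_scaleC)

lemma bounded_linear_scaleC_left:
  "bounded_linear (\<lambda>c. c *\<^sub>C (x :: 'a::complex_hilbert_space))"
proof (rule bounded_linear_intro[where K = "norm x"])
  show "(r *\<^sub>R c) *\<^sub>C x = r *\<^sub>R c *\<^sub>C x" for r c
    by (metis scaleC_of_real scaleC_scaleC scaleR_conv_of_real)
qed (auto simp: scaleC_add_left norm_scaleC)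

lemma bounded_linear_cinner_left:
  "bounded_linear (\<lambda>x. cinner x (y :: 'a::complex_hilbert_space))"
proof (rule bounded_linear_intro[where K = "norm y"])
  show "cinner (r *\<^sub>R x) y = r *\<^sub>R cinner x y" for r and x :: 'a
    by (simp add: cinner_scaleR_left scaleR_conv_of_real)
qed (auto simp: cinner_add_left cmod_cinner_le)

lemma csubspace_cspan: "csubspace (cspan S)"
  unfolding cspan_def by (rule hull_in) (auto simp: csubspace_def)

lemma cspan_superset: "S \<subseteq> cspan S"
  unfolding cspan_def by (rule hull_subset)

lemma cspan_minimal: "S \<subseteq> T \<Longrightarrow> csubspace T \<Longrightarrow> cspan S \<subseteq> T"
  unfolding cspan_def by (rule hull_minimal)

lemma csubspace_zero: "csubspace S \<Longrightarrow> 0 \<in> S"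
  by (simp add: csubspace_def)

lemma csubspace_add: "csubspace S \<Longrightarrow> x \<in> S \<Longrightarrow> y \<in> S \<Longrightarrow> x + y \<in> S"
  by (simp add: csubspace_def)

lemma csubspace_scaleC: "csubspace S \<Longrightarrow> x \<in> S \<Longrightarrow> c *\<^sub>C x \<in> S"
  by (simp add: csubspace_def)

lemma csubspace_scaleR: "csubspace S \<Longrightarrow> x \<in> S \<Longrightarrow> r *\<^sub>R x \<in> S"
  unfolding csubspace_def by (metis scaleC_of_real)

lemma csubspace_diff: "csubspace S \<Longrightarrow> x \<in> S \<Longrightarrow> y \<in> S \<Longrightarrow> x - y \<in> S"
  using csubspace_scaleR[of S y "-1"] unfolding csubspace_def by (metis diff_conv_add_uminus scaleR_minus1_left)

lemma csubspace_sum: "csubspace S \<Longrightarrow> (\<And>i. i \<in> I \<Longrightarrow> f i \<in> S) \<Longrightarrow> sum f I \<in> S"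
  by (induction I rule: infinite_finite_induct) (auto simp: csubspace_def)

lemma csubspace_orthogonal: "csubspace {x. \<forall>y\<in>T. cinner x y = 0}"
  by (auto simp: csubspace_def cinner_add_left cinner_scaleC_left)

lemma cspan_orthogonal:
  assumes "\<And>x y. x \<in> S \<Longrightarrow> y \<in> T \<Longrightarrow> cinner x y = 0"
    and "x \<in> cspan S" "y \<in> cspan T"
  shows "cinner x y = 0"
proof -
  have "cspan S \<subseteq> {x. \<forall>y\<in>T. cinner x y = 0}"
    by (rule cspan_minimal) (use assms(1) csubspace_orthogonal in auto)
  then have "\<forall>y\<in>T. cinner y x = 0"
    using assms(2) cinner_eq_zero_commute by blast
  then have "cspan T \<subseteq> {y. \<forall>x\<in>{x}. cinner y x = 0}"
    by (intro cspan_minimal csubspace_orthogonal) auto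
  then show ?thesis
    using assms(3) cinner_eq_zero_commute by blast
qed

lemma csubspace_closure:
  assumes "csubspace S"
  shows "csubspace (closure S)"
  unfolding csubspace_def
proof (intro conjI ballI allI)
  show "0 \<in> closure S"
    using assms closure_subset by (auto simp: csubspace_def)
next
  fix x y assume "x \<in> closure S" "y \<in> closure S"
  then obtain f g where "\<forall>n. f n \<in> S" "f \<longlonglongrightarrow> x" "\<forall>n. g n \<in> S" "g \<longlonglongrightarrow> y"
    by (auto simp: closure_sequential)
  with assms show "x + y \<in> closure S"
    unfolding closure_sequential csubspace_def
    by (intro exI[of _ "\<lambda>n. f n + g n"]) (auto intro: tendsto_add)
next
  fix c x assume "x \<in> closure S"
  then obtain f where "\<forall>n. f n \<in> S" "f \<longlonglongrightarrow> x"
    by (auto simp: closure_sequential)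
  with assms show "c *\<^sub>C x \<in> closure S"
    unfolding closure_sequential csubspace_def
    by (intro exI[of _ "\<lambda>n. c *\<^sub>C f n"]) (auto intro: bounded_linear.tendsto[OF bounded_linear_scaleC])
qed

text \<open>
  A minimizing sequence for the distance to the subspace is Cauchy by the parallelogram law, and the
  difference to its limit is orthogonal to the subspace since no real multiple of a vector of the
  subspace brings it closer to the origin.
\<close>
lemma exists_orthogonal_vector:
  fixes L :: "'a::complex_hilbert_space set"
  assumes sub: "csubspace L" and "closed L" and "L \<noteq> UNIV"
  shows "\<exists>w. w \<noteq> 0 \<and> (\<forall>y\<in>L. cinner w y = 0)"
proof -
  obtain x where x: "x \<notin> L"
    using assms by auto
  have ne: "L \<noteq> {}"
    using sub by (auto simp: csubspace_def)
  define d where "d = infdist x L"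
  have d: "d \<le> norm (x - y)" if "y \<in> L" for y
    unfolding d_def dist_norm[symmetric] by (rule infdist_le) fact
  have d0: "0 \<le> d"
    by (simp add: d_def infdist_nonneg)
  have "\<exists>y\<in>L. (norm (x - y))\<^sup>2 < d\<^sup>2 + 1 / real (Suc n)" for n
  proof -
    have "d < sqrt (d\<^sup>2 + 1 / real (Suc n))"
      by (rule real_less_rsqrt) simp
    then obtain y where y: "y \<in> L" "norm (x - y) < sqrt (d\<^sup>2 + 1 / real (Suc n))"
      using infdist_notempty[OF ne] unfolding d_def
      by (metis bdd_below_image_dist cINF_less_iff dist_norm ne)
    then have "(norm (x - y))\<^sup>2 < (sqrt (d\<^sup>2 + 1 / real (Suc n)))\<^sup>2"
      by (intro power_strict_mono) auto
    also have "\<dots> = d\<^sup>2 + 1 / real (Suc n)"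
      by (intro real_sqrt_pow2) auto
    finally show ?thesis
      using y by blast
  qed
  then obtain y where yL: "\<And>n. y n \<in> L" and y: "\<And>n. (norm (x - y n))\<^sup>2 < d\<^sup>2 + 1 / real (Suc n)"
    by metis
  have close: "(norm (y m - y n))\<^sup>2 < 4 / real (Suc k)" if "k \<le> m" "k \<le> n" for m n k
  proof -
    have "(1/2) *\<^sub>R (y m + y n) \<in> L"
      using sub yL by (intro csubspace_scaleR) (auto simp: csubspace_def)
    then have "d\<^sup>2 \<le> (norm (x - (1/2) *\<^sub>R (y m + y n)))\<^sup>2"
      using d d0 by (intro power_mono) auto
    moreover have "(norm (y m - y n))\<^sup>2 + 4 * (norm (x - (1/2) *\<^sub>R (y m + y n)))\<^sup>2
        = 2 * (norm (x - y m))\<^sup>2 + 2 * (norm (x - y n))\<^sup>2"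
      by (simp add: power2_norm_eq_inner inner_diff inner_add inner_commute algebra_simps)
    moreover have "1 / real (Suc m) \<le> 1 / real (Suc k)" "1 / real (Suc n) \<le> 1 / real (Suc k)"
      using that by (auto intro: divide_left_mono)
    ultimately show ?thesis
      using y[of m] y[of n] by simp
  qed
  have "Cauchy y"
  proof (rule metric_CauchyI)
    fix e :: real assume "e > 0"
    obtain k where "4 / e\<^sup>2 < real k"
      using reals_Archimedean2 by blast
    then have "4 / e\<^sup>2 < real (Suc k)"
      by simp
    then have k: "4 / real (Suc k) < e\<^sup>2"
      using \<open>e > 0\<close> by (simp add: field_simps)
    have "dist (y m) (y n) < e" if "k \<le> m" "k \<le> n" for m n
    proof -
      have "(norm (y m - y n))\<^sup>2 < e\<^sup>2"
        using close[OF that] k by linarith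
      then show ?thesis
        unfolding dist_norm by (rule power_less_imp_less_base) (use \<open>e > 0\<close> in simp)
    qed
    then show "\<exists>M. \<forall>m\<ge>M. \<forall>n\<ge>M. dist (y m) (y n) < e"
      by blast
  qed
  then obtain p where p: "y \<longlonglongrightarrow> p"
    using Cauchy_convergent_iff convergent_def by blast
  have pL: "p \<in> L"
    using assms(2) yL p closed_sequentially by blast
  have "(\<lambda>n. (norm (x - y n))\<^sup>2) \<longlonglongrightarrow> (norm (x - p))\<^sup>2"
    by (intro tendsto_intros p)
  moreover have "(\<lambda>n. d\<^sup>2 + 1 / real (Suc n)) \<longlonglongrightarrow> d\<^sup>2 + 0"
    by (intro tendsto_add tendsto_const LIMSEQ_Suc[OF lim_1_over_n])
  ultimately have min: "(norm (x - p))\<^sup>2 \<le> d\<^sup>2"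
    using LIMSEQ_le[of _ "(norm (x - p))\<^sup>2" _ "d\<^sup>2"] y by (simp add: less_imp_le)
  have real_orth: "inner (x - p) z = 0" if "z \<in> L" for z
  proof (rule ccontr)
    assume nz: "inner (x - p) z \<noteq> 0"
    \<comment> \<open>the minimizer of \<open>norm (x - p - t *\<^sub>R z)\<close> over the real numbers \<open>t\<close>\<close>
    define t where "t = inner (x - p) z / inner z z"
    have z0: "inner z z > 0"
      using nz by auto
    have "p + t *\<^sub>R z \<in> L"
      using sub pL that csubspace_scaleR[OF sub that] by (auto simp: csubspace_def)
    then have "d\<^sup>2 \<le> (norm (x - (p + t *\<^sub>R z)))\<^sup>2"
      using d d0 by (intro power_mono) auto
    also have "\<dots> = (norm (x - p))\<^sup>2 - 2 * t * inner (x - p) z + t * t * inner z z"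
      by (simp add: power2_norm_eq_inner inner_diff inner_add inner_commute algebra_simps)
    also have "\<dots> = (norm (x - p))\<^sup>2 - (inner (x - p) z)\<^sup>2 / inner z z"
      using z0 by (simp add: t_def field_simps power2_eq_square)
    also have "\<dots> < (norm (x - p))\<^sup>2"
      using nz z0 by simp
    finally show False
      using min by simp
  qed
  have "cinner (x - p) z = 0" if "z \<in> L" for z
  proof -
    have "\<i> *\<^sub>C z \<in> L"
      using that sub by (auto simp: csubspace_def)
    then have "Re (cinner (x - p) (\<i> *\<^sub>C z)) = 0" "Re (cinner (x - p) z) = 0"
      using real_orth that by (auto simp: inner_eq_Re_cinner[symmetric])
    then show ?thesis
      by (simp add: cinner_scaleC_right complex_eq_iff)
  qed
  moreover have "x - p \<noteq> 0"
    using x pL by auto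
  ultimately show ?thesis
    by blast
qed

lemma norm_add_orthogonal:
  assumes "cinner x y = 0"
  shows "(norm (x + y))\<^sup>2 = (norm x)\<^sup>2 + (norm y)\<^sup>2"
  using assms by (intro norm_add_Pythagorean) (auto simp: orthogonal_def inner_eq_Re_cinner)

lemma norm_sum_orthonormal:
  assumes "finite I" "\<And>i. i \<in> I \<Longrightarrow> norm (e i) = 1"
    and "\<And>i j. i \<in> I \<Longrightarrow> j \<in> I \<Longrightarrow> i \<noteq> j \<Longrightarrow> cinner (e i) (e j) = 0"
  shows "(norm (\<Sum>i\<in>I. c i *\<^sub>C e i))\<^sup>2 = (\<Sum>i\<in>I. (cmod (c i))\<^sup>2)"
proof -
  have "(norm (\<Sum>i\<in>I. c i *\<^sub>C e i))\<^sup>2 = (\<Sum>i\<in>I. (norm (c i *\<^sub>C e i))\<^sup>2)"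
    using assms by (intro norm_sum_Pythagorean)
      (auto simp: pairwise_def orthogonal_def inner_eq_Re_cinner cinner_scaleC_left cinner_scaleC_right)
  also have "\<dots> = (\<Sum>i\<in>I. (cmod (c i))\<^sup>2)"
    using assms by (intro sum.cong) (auto simp: norm_scaleC)
  finally show ?thesis .
qed

lemma Bessel_inequality:
  assumes "finite I" "\<And>i. i \<in> I \<Longrightarrow> norm (e i) = 1"
    and "\<And>i j. i \<in> I \<Longrightarrow> j \<in> I \<Longrightarrow> i \<noteq> j \<Longrightarrow> cinner (e i) (e j) = 0"
  shows "(\<Sum>i\<in>I. (cmod (cinner x (e i)))\<^sup>2) \<le> (norm x)\<^sup>2"
proof -
  define p where "p = (\<Sum>i\<in>I. cinner x (e i) *\<^sub>C e i)"
  have "cinner p (e j) = cinner x (e j)" if "j \<in> I" for j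
  proof -
    have "cinner p (e j) = (\<Sum>i\<in>I. if i = j then cinner x (e j) else 0)"
      unfolding p_def cinner_sum_left cinner_scaleC_left
      using assms that by (intro sum.cong) (auto simp: cinner_self)
    with that assms(1) show ?thesis
      by simp
  qed
  moreover have "cinner q p = (\<Sum>i\<in>I. cnj (cinner x (e i)) * cinner q (e i))" for q
    unfolding p_def by (simp add: cinner_sum_right cinner_scaleC_right)
  ultimately have "cinner (x - p) p = 0"
    by (simp add: cinner_diff_left)
  then have "(norm (x - p + p))\<^sup>2 = (norm (x - p))\<^sup>2 + (norm p)\<^sup>2"
    by (rule norm_add_orthogonal)
  moreover have "(norm p)\<^sup>2 = (\<Sum>i\<in>I. (cmod (cinner x (e i)))\<^sup>2)"
    unfolding p_def by (rule norm_sum_orthonormal) (use assms in auto)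
  ultimately show ?thesis
    by simp
qed

section \<open>Rank one operators and finite partial isometries\<close>

text \<open>
  In Dirac notation, \<open>rank_one a b\<close> is the operator \<open>|a\<rangle>\<langle>b|\<close>.
\<close>
definition rank_one ::
    "'b::complex_hilbert_space \<Rightarrow> 'a::complex_hilbert_space \<Rightarrow> ('a \<Rightarrow>\<^sub>L 'b)"
  where "rank_one a b = Blinfun (\<lambda>x. cinner x b *\<^sub>C a)"

lemma rank_one_apply [simp]: "blinfun_apply (rank_one a b) x = cinner x b *\<^sub>C a"
proof -
  have "bounded_linear (\<lambda>x. cinner x b *\<^sub>C a)"
    by (rule bounded_linear_compose[OF bounded_linear_scaleC_left bounded_linear_cinner_left])
  then show ?thesis
    unfolding rank_one_def by (simp add: bounded_linear_Blinfun_apply)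
qed

lemma rank_one_clinear: "rank_one a b \<in> clinear_ops"
  by (simp add: clinear_ops_def cinner_scaleC_left scaleC_scaleC)

lemma compact_operator_rank_one: "compact_operator (rank_one a b)"
proof -
  define K where "K = (\<lambda>c. c *\<^sub>C a) ` cball 0 (norm b)"
  have "compact K"
    unfolding K_def by (intro compact_continuous_image compact_cball
        bounded_linear.continuous_on[OF bounded_linear_scaleC_left] continuous_on_id)
  moreover have "blinfun_apply (rank_one a b) ` cball 0 1 \<subseteq> K"
  proof
    fix y assume "y \<in> blinfun_apply (rank_one a b) ` cball 0 1"
    then obtain x where x: "norm x \<le> 1" "y = cinner x b *\<^sub>C a"
      by auto
    have "cmod (cinner x b) \<le> norm x * norm b"
      by (rule cmod_cinner_le)
    also have "\<dots> \<le> 1 * norm b"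
      using x by (intro mult_right_mono) auto
    finally show "y \<in> K"
      using x by (auto simp: K_def)
  qed
  ultimately have "closure (blinfun_apply (rank_one a b) ` cball 0 1) \<subseteq> K" "compact K"
    by (simp_all only: closure_minimal compact_imp_closed)
  then show ?thesis
    unfolding compact_operator_def by (metis closed_closure compact_Int_closed inf.absorb_iff2)
qed

lemma rank_one_comp_rank_one:
  "norm y = 1 \<Longrightarrow> rank_one a y o\<^sub>L rank_one y b = rank_one a b"
  by (intro blinfun_eqI) (simp add: cinner_scaleC_left cinner_self)

text \<open>
  A set of pairs \<open>(a, b)\<close> encodes the partial isometry that takes each \<open>b\<close> to its \<open>a\<close> and
  annihilates the orthogonal complement of all second components.
\<close>
definition orthonormal_pairs :: "('a::complex_hilbert_space \<times> 'a) set \<Rightarrow> bool"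
  where "orthonormal_pairs S \<longleftrightarrow> finite S \<and>
    (\<forall>p\<in>S. norm (fst p) = 1 \<and> norm (snd p) = 1) \<and>
    (\<forall>p\<in>S. \<forall>q\<in>S. p \<noteq> q \<longrightarrow> cinner (fst p) (fst q) = 0 \<and> cinner (snd p) (snd q) = 0)"

definition pair_isometry :: "('a::complex_hilbert_space \<times> 'a) set \<Rightarrow> ('a \<Rightarrow>\<^sub>L 'a)"
  where "pair_isometry S = (\<Sum>p\<in>S. rank_one (fst p) (snd p))"

lemma pair_isometry_apply:
  "blinfun_apply (pair_isometry S) x = (\<Sum>p\<in>S. cinner x (snd p) *\<^sub>C fst p)"
  by (simp add: pair_isometry_def blinfun.sum_left)

lemma pair_isometry_clinear: "pair_isometry S \<in> clinear_ops"
  by (simp add: clinear_ops_def pair_isometry_apply cinner_scaleC_left scaleC_scaleC scaleC_sum_right)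

lemma finite_rank_pair_isometry:
  assumes "finite S"
  shows "finite_rank (pair_isometry S)"
proof -
  have "blinfun_apply (pair_isometry S) x \<in> cspan (fst ` S)" for x
    unfolding pair_isometry_apply
    by (intro csubspace_sum csubspace_scaleC csubspace_cspan subsetD[OF cspan_superset]) simp
  with assms show ?thesis
    unfolding finite_rank_def by (intro exI[of _ "fst ` S"]) auto
qed

lemma pair_isometry_contraction:
  assumes "orthonormal_pairs S"
  shows "norm (blinfun_apply (pair_isometry S) x) \<le> norm x"
proof -
  have "(norm (blinfun_apply (pair_isometry S) x))\<^sup>2 = (\<Sum>p\<in>S. (cmod (cinner x (snd p)))\<^sup>2)"
    unfolding pair_isometry_apply
    by (rule norm_sum_orthonormal) (use assms in \<open>auto simp: orthonormal_pairs_def\<close>)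
  also have "\<dots> \<le> (norm x)\<^sup>2"
    by (rule Bessel_inequality) (use assms in \<open>auto simp: orthonormal_pairs_def\<close>)
  finally show ?thesis
    by (rule power2_le_imp_le) simp
qed

lemma norm_pair_isometry_le: "orthonormal_pairs S \<Longrightarrow> norm (pair_isometry S) \<le> 1"
  by (rule norm_blinfun_bound) (auto intro: pair_isometry_contraction)


section \<open>Rows and columns of rank one operators\<close>

lemma l2_norm_leI:
  assumes "finite {k. h k \<noteq> 0}" "(\<Sum>k | h k \<noteq> 0. (norm (h k))\<^sup>2) \<le> 1"
  shows "l2_norm h \<le> 1"
proof -
  have "(\<Sum>k. (norm (h k))\<^sup>2) = (\<Sum>k | h k \<noteq> 0. (norm (h k))\<^sup>2)"
    using assms(1) by (intro suminf_finite) auto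
  then show ?thesis
    using assms(2) by (simp add: l2_norm_def)
qed

lemma sum_norm_le_of_l2_norm:
  assumes "h \<in> l2_seqs" "l2_norm h \<le> 1" "finite I"
  shows "(\<Sum>k\<in>I. (norm (h k))\<^sup>2) \<le> 1"
proof -
  have "(\<Sum>k\<in>I. (norm (h k))\<^sup>2) \<le> (\<Sum>k. (norm (h k))\<^sup>2)"
    using assms by (intro sum_le_suminf) (auto simp: l2_seqs_def)
  also have "\<dots> \<le> 1"
    using assms(2) by (simp add: l2_norm_def)
  finally show ?thesis .
qed

text \<open>
  A row \<open>(|a\<^sub>k\<rangle>\<langle>y\<^sub>k|)\<^sub>k\<close> with orthonormal \<open>a\<^sub>k\<close> is a contraction even though
  the \<open>y\<^sub>k\<close> are arbitrary unit vectors, since distinct entries act on distinct summands.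
\<close>
lemma rank_one_row_in_ball:
  fixes a :: "nat \<Rightarrow> 'a::complex_hilbert_space" and y :: "nat \<Rightarrow> 'b::complex_hilbert_space"
  assumes a: "\<And>k. k < n \<Longrightarrow> norm (a k) = 1"
    and orth: "\<And>j k. j < n \<Longrightarrow> k < n \<Longrightarrow> j \<noteq> k \<Longrightarrow> cinner (a j) (a k) = 0"
    and y: "\<And>k. k < n \<Longrightarrow> norm (y k) = 1"
    and Z: "0 \<in> Z" "\<And>k. k < n \<Longrightarrow> rank_one (a k) (y k) \<in> Z"
  shows "(\<lambda>k. if k < n then rank_one (a k) (y k) else 0) \<in> row_ball Z" (is "?v \<in> _")
proof -
  have supp: "{k. ?v k \<noteq> 0} \<subseteq> {..<n}"
    by auto
  have "norm (row_apply ?v h) \<le> 1" if h: "h \<in> l2_seqs" "l2_norm h \<le> 1" for h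
  proof -
    have "row_apply ?v h = (\<Sum>k<n. blinfun_apply (?v k) (h k))"
      unfolding row_apply_def
      by (rule sum.mono_neutral_left[OF _ supp]) (auto simp del: rank_one_apply)
    also have "\<dots> = (\<Sum>k<n. cinner (h k) (y k) *\<^sub>C a k)"
      by (intro sum.cong) auto
    finally have "row_apply ?v h = (\<Sum>k<n. cinner (h k) (y k) *\<^sub>C a k)" .
    then have "(norm (row_apply ?v h))\<^sup>2 = (\<Sum>k<n. (cmod (cinner (h k) (y k)))\<^sup>2)"
      by (simp only:) (rule norm_sum_orthonormal, use a orth in auto)
    also have "\<dots> \<le> (\<Sum>k<n. (norm (h k))\<^sup>2)"
    proof (intro sum_mono power_mono)
      show "cmod (cinner (h k) (y k)) \<le> norm (h k)" if "k \<in> {..<n}" for k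
        using cmod_cinner_le[of "h k" "y k"] y that by simp
    qed simp
    also have "\<dots> \<le> 1"
      using h by (intro sum_norm_le_of_l2_norm) auto
    finally show ?thesis
      by (simp add: power2_le_imp_le[where y = 1])
  qed
  moreover have "(\<lambda>_. 0) \<in> {h :: nat \<Rightarrow> 'b. h \<in> l2_seqs \<and> l2_norm h \<le> 1}"
    by (simp add: l2_seqs_def l2_norm_def)
  ultimately have "row_norm ?v \<le> 1"
    unfolding row_norm_def by (intro cSUP_least) auto
  moreover have "finite {k. ?v k \<noteq> 0}"
    using supp finite_subset by blast
  ultimately show ?thesis
    unfolding row_ball_def fin_supp_seqs_def using Z by auto
qed

lemma rank_one_column_in_ball:
  fixes b :: "nat \<Rightarrow> 'a::complex_hilbert_space" and y :: "nat \<Rightarrow> 'b::complex_hilbert_space"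
  assumes b: "\<And>k. k < n \<Longrightarrow> norm (b k) = 1"
    and orth: "\<And>j k. j < n \<Longrightarrow> k < n \<Longrightarrow> j \<noteq> k \<Longrightarrow> cinner (b j) (b k) = 0"
    and y: "\<And>k. k < n \<Longrightarrow> norm (y k) = 1"
    and Z: "0 \<in> Z" "\<And>k. k < n \<Longrightarrow> rank_one (y k) (b k) \<in> Z"
  shows "(\<lambda>k. if k < n then rank_one (y k) (b k) else 0) \<in> col_ball Z" (is "?u \<in> _")
proof -
  have "l2_norm (col_apply ?u x) \<le> 1" if x: "norm x \<le> 1" for x
  proof (rule l2_norm_leI)
    have supp: "{k. col_apply ?u x k \<noteq> 0} \<subseteq> {..<n}"
      by (auto simp: col_apply_def)
    then show "finite {k. col_apply ?u x k \<noteq> 0}"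
      using finite_subset by blast
    have "(\<Sum>k | col_apply ?u x k \<noteq> 0. (norm (col_apply ?u x k))\<^sup>2)
        = (\<Sum>k<n. (norm (col_apply ?u x k))\<^sup>2)"
      by (rule sum.mono_neutral_left[OF _ supp]) auto
    also have "\<dots> = (\<Sum>k<n. (cmod (cinner x (b k)))\<^sup>2)"
      using y by (intro sum.cong) (auto simp: col_apply_def norm_scaleC)
    also have "\<dots> \<le> (norm x)\<^sup>2"
      by (rule Bessel_inequality) (use b orth in auto)
    also have "\<dots> \<le> 1"
      using x by (simp add: power_le_one)
    finally show "(\<Sum>k | col_apply ?u x k \<noteq> 0. (norm (col_apply ?u x k))\<^sup>2) \<le> 1" .
  qed
  then have "col_norm ?u \<le> 1"
    unfolding col_norm_def by (intro cSUP_least) (auto intro: exI[of _ 0])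
  moreover have "finite {k. ?u k \<noteq> 0}"
    by (rule finite_subset[of _ "{..<n}"]) auto
  ultimately show ?thesis
    unfolding col_ball_def fin_supp_seqs_def using Z by auto
qed

text \<open>
  The pairs are numbered and each is routed through a summand of its own, so that the product of the
  row and the column has no cross terms.
\<close>
lemma pair_isometry_factorization:
  fixes X :: "('a::complex_hilbert_space \<Rightarrow>\<^sub>L 'b::complex_hilbert_space) set" and Y :: "('b \<Rightarrow>\<^sub>L 'a) set"
  assumes S: "orthonormal_pairs S" and "0 \<in> X" "0 \<in> Y"
    and factor: "\<And>p. p \<in> S \<Longrightarrow>
      \<exists>y. norm y = 1 \<and> rank_one (fst p) y \<in> Y \<and> rank_one y (snd p) \<in> X"
  shows "\<exists>v\<in>row_ball Y. \<exists>u\<in>col_ball X. row_col_prod v u = pair_isometry S"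
proof -
  obtain y where y: "\<And>p. p \<in> S \<Longrightarrow>
      norm (y p) = 1 \<and> rank_one (fst p) (y p) \<in> Y \<and> rank_one (y p) (snd p) \<in> X"
    using factor by metis
  define n where "n = card S"
  obtain g where g: "bij_betw g {..<n} S"
    using S ex_bij_betw_nat_finite[of S] by (auto simp: orthonormal_pairs_def n_def atLeast0LessThan)
  have gS: "g k \<in> S" if "k < n" for k
    using g that by (auto simp: bij_betw_def)
  have g_neq: "g j \<noteq> g k" if "j < n" "k < n" "j \<noteq> k" for j k
    using g that by (auto simp: bij_betw_def inj_on_def)
  define v where "v = (\<lambda>k. if k < n then rank_one (fst (g k)) (y (g k)) else 0)"
  define u where "u = (\<lambda>k. if k < n then rank_one (y (g k)) (snd (g k)) else 0)"
  have "v \<in> row_ball Y"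
    unfolding v_def using S gS g_neq y assms
    by (intro rank_one_row_in_ball) (auto simp: orthonormal_pairs_def)
  moreover have "u \<in> col_ball X"
    unfolding u_def using S gS g_neq y assms
    by (intro rank_one_column_in_ball) (auto simp: orthonormal_pairs_def)
  moreover have "row_col_prod v u = pair_isometry S"
  proof -
    have "row_col_prod v u = (\<Sum>k<n. v k o\<^sub>L u k)"
      unfolding row_col_prod_def by (rule sum.mono_neutral_left) (auto simp: v_def)
    also have "\<dots> = (\<Sum>k<n. rank_one (fst (g k)) (snd (g k)))"
      using y gS by (intro sum.cong) (auto simp: v_def u_def rank_one_comp_rank_one)
    also have "\<dots> = pair_isometry S"
      unfolding pair_isometry_def by (rule sum.reindex_bij_betw[OF g])
    finally show ?thesis .
  qed
  ultimately show ?thesis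
    by blast
qed

section \<open>Orthogonal projections\<close>

lemma orthogonal_projection_idem:
  "orthogonal_projection P \<Longrightarrow> blinfun_apply P (blinfun_apply P x) = blinfun_apply P x"
  unfolding orthogonal_projection_def by (metis blinfun_apply_blinfun_compose)

lemma orthogonal_projection_adjoint:
  "orthogonal_projection P \<Longrightarrow> cinner (blinfun_apply P x) y = cinner x (blinfun_apply P y)"
  by (simp add: orthogonal_projection_def)

lemma orthogonal_projection_scaleC:
  "orthogonal_projection P \<Longrightarrow> blinfun_apply P (c *\<^sub>C x) = c *\<^sub>C blinfun_apply P x"
  by (simp add: orthogonal_projection_def clinear_ops_def)

lemma range_orthogonal_projection:
  "orthogonal_projection P \<Longrightarrow> x \<in> range (blinfun_apply P) \<longleftrightarrow> blinfun_apply P x = x"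
  using orthogonal_projection_idem by (metis rangeE rangeI)

lemma csubspace_range_projection:
  assumes "orthogonal_projection P"
  shows "csubspace (range (blinfun_apply P))"
  unfolding csubspace_def range_orthogonal_projection[OF assms]
  using assms
  by (auto simp: blinfun.add_right orthogonal_projection_scaleC orthogonal_projection_idem)

lemma orthogonal_projection_pythagoras:
  assumes "orthogonal_projection P"
  shows "(norm x)\<^sup>2 = (norm (x - blinfun_apply P x))\<^sup>2 + (norm (blinfun_apply P x))\<^sup>2"
proof -
  have "cinner (x - blinfun_apply P x) (blinfun_apply P x) = 0"
    using orthogonal_projection_adjoint[OF assms, of "x - blinfun_apply P x" x]
    by (simp add: blinfun.diff_right orthogonal_projection_idem[OF assms])
  from norm_add_orthogonal[OF this] show ?thesis
    by simp
qed

lemma norm_projection_le: "orthogonal_projection P \<Longrightarrow> norm (blinfun_apply P x) \<le> norm x"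
  using orthogonal_projection_pythagoras[of P x] by (auto intro: power2_le_imp_le)

lemma norm_diff_projection_le:
  "orthogonal_projection P \<Longrightarrow> norm (x - blinfun_apply P x) \<le> norm x"
  using orthogonal_projection_pythagoras[of P x] by (auto intro: power2_le_imp_le)

lemma proj_le_refl: "proj_le P P"
  by (simp add: proj_le_def)

lemma proj_le_comp1:
  assumes "orthogonal_projection Q" "proj_le P Q"
  shows "blinfun_apply Q (blinfun_apply P x) = blinfun_apply P x"
  using assms range_orthogonal_projection[of Q] unfolding proj_le_def by blast

lemma proj_le_comp2:
  assumes P: "orthogonal_projection P" and Q: "orthogonal_projection Q" and "proj_le P Q"
  shows "blinfun_apply P (blinfun_apply Q x) = blinfun_apply P x"
proof -
  have "cinner (blinfun_apply P (blinfun_apply Q x) - blinfun_apply P x) y = 0" for y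
    by (simp add: cinner_diff_left orthogonal_projection_adjoint[OF P]
        orthogonal_projection_adjoint[OF Q] proj_le_comp1[OF Q assms(3)])
  then show ?thesis
    using cinner_nondegenerate right_minus_eq by blast
qed

lemma proj_le_norm_diff:
  assumes P: "orthogonal_projection P" and Q: "orthogonal_projection Q" and "proj_le P Q"
  shows "(norm (blinfun_apply Q x - blinfun_apply P x))\<^sup>2
    = (norm (blinfun_apply Q x))\<^sup>2 - (norm (blinfun_apply P x))\<^sup>2"
  using orthogonal_projection_pythagoras[OF P, of "blinfun_apply Q x"] proj_le_comp2[OF assms]
  by simp

lemma proj_le_norm_le:
  assumes "orthogonal_projection P" "orthogonal_projection Q" "proj_le P Q"
  shows "norm (blinfun_apply P x) \<le> norm (blinfun_apply Q x)"
proof (rule power2_le_imp_le)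
  show "(norm (blinfun_apply P x))\<^sup>2 \<le> (norm (blinfun_apply Q x))\<^sup>2"
    using proj_le_norm_diff[OF assms, of x]
      zero_le_power2[of "norm (blinfun_apply Q x - blinfun_apply P x)"] by linarith
qed simp


section \<open>Nests\<close>

lemma nest_projection: "nest N \<Longrightarrow> P \<in> N \<Longrightarrow> orthogonal_projection P"
  by (simp add: nest_def)

lemma nest_total: "nest N \<Longrightarrow> P \<in> N \<Longrightarrow> Q \<in> N \<Longrightarrow> proj_le P Q \<or> proj_le Q P"
  by (simp add: nest_def)

lemma nest_zero: "nest N \<Longrightarrow> 0 \<in> N" and nest_id: "nest N \<Longrightarrow> id_blinfun \<in> N"
  by (simp_all add: nest_def)

lemma nest_comp_mem:
  assumes "nest N" "P \<in> N" "Q \<in> N"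
  shows "P o\<^sub>L Q = P \<or> P o\<^sub>L Q = Q"
  using nest_total[OF assms] proj_le_comp1[of P Q] proj_le_comp2[of P Q]
    nest_projection[OF assms(1)] assms
  by (metis blinfun_apply_blinfun_compose blinfun_eqI)

lemma nest_norm_diff:
  assumes N: "nest N" and A: "A \<in> N" and B: "B \<in> N"
  shows "(norm (blinfun_apply A x - blinfun_apply B x))\<^sup>2
    = \<bar>(norm (blinfun_apply A x))\<^sup>2 - (norm (blinfun_apply B x))\<^sup>2\<bar>"
proof -
  have le: "(norm (blinfun_apply Q x - blinfun_apply P x))\<^sup>2
      = \<bar>(norm (blinfun_apply Q x))\<^sup>2 - (norm (blinfun_apply P x))\<^sup>2\<bar>"
    if "P \<in> N" "Q \<in> N" "proj_le P Q" for P Q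
    using proj_le_norm_diff[of P Q x] that nest_projection[OF N]
      zero_le_power2[of "norm (blinfun_apply Q x - blinfun_apply P x)"] by simp
  from nest_total[OF N A B] show ?thesis
  proof
    assume "proj_le A B"
    then show ?thesis
      using le[OF A B] by (metis norm_minus_commute abs_minus_commute)
  next
    assume "proj_le B A"
    then show ?thesis
      by (rule le[OF B A])
  qed
qed

text \<open>
  The ranges of a chain of projections have a subspace as their union, so that the closed span in
  the definition of a supremum is a closure of a union.
\<close>
lemma nest_Sup:
  fixes N :: "('a::complex_hilbert_space \<Rightarrow>\<^sub>L 'a) set"
  assumes N: "nest N" and S: "S \<subseteq> N" "S \<noteq> {}"
  obtains P where "P \<in> N" "\<And>M. M \<in> S \<Longrightarrow> proj_le M P"
    "\<And>x e. e > 0 \<Longrightarrow> \<exists>M\<in>S. norm (blinfun_apply P x - blinfun_apply M x) < e"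
proof -
  define U where "U = (\<Union>Q\<in>S. range (blinfun_apply Q))"
  obtain P where P: "P \<in> N" "range (blinfun_apply P) = closure (cspan U)"
    using N S unfolding nest_def U_def by meson
  have sub: "csubspace (range (blinfun_apply Q))" if "Q \<in> S" for Q
    using that S N csubspace_range_projection nest_projection by blast
  have "csubspace U"
    unfolding csubspace_def
  proof (intro conjI ballI allI)
    show "0 \<in> U"
      unfolding U_def using S(2) csubspace_zero[OF sub] by blast
  next
    fix x y assume "x \<in> U" "y \<in> U"
    then obtain Q R where QR: "Q \<in> S" "x \<in> range (blinfun_apply Q)"
        "R \<in> S" "y \<in> range (blinfun_apply R)"
      unfolding U_def by blast
    then have "proj_le Q R \<or> proj_le R Q"
      using N S nest_total by blast
    then have "\<exists>T\<in>S. x \<in> range (blinfun_apply T) \<and> y \<in> range (blinfun_apply T)"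
      using QR unfolding proj_le_def by blast
    then obtain T where "T \<in> S" "x \<in> range (blinfun_apply T)" "y \<in> range (blinfun_apply T)"
      by blast
    then have "x + y \<in> range (blinfun_apply T)"
      by (intro csubspace_add sub)
    with \<open>T \<in> S\<close> show "x + y \<in> U"
      unfolding U_def by blast
  next
    fix c x assume "x \<in> U"
    then obtain Q where Q: "Q \<in> S" "x \<in> range (blinfun_apply Q)"
      unfolding U_def by blast
    then have "c *\<^sub>C x \<in> range (blinfun_apply Q)"
      by (intro csubspace_scaleC sub)
    with Q show "c *\<^sub>C x \<in> U"
      unfolding U_def by blast
  qed
  then have range: "range (blinfun_apply P) = closure U"
    unfolding P(2) cspan_def by (simp add: hull_same)
  have le: "proj_le M P" if "M \<in> S" for M
    using that closure_subset[of U] unfolding proj_le_def range U_def by blast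
  have "\<exists>M\<in>S. norm (blinfun_apply P x - blinfun_apply M x) < e" if "e > 0" for x e
  proof -
    have "blinfun_apply P x \<in> closure U"
      using range by blast
    then obtain w where "w \<in> U" and w: "dist w (blinfun_apply P x) < e"
      using closure_approachable \<open>e > 0\<close> by blast
    then obtain M where M: "M \<in> S" "w \<in> range (blinfun_apply M)"
      unfolding U_def by blast
    have oM: "orthogonal_projection M" and oP: "orthogonal_projection P"
      using M P S N nest_projection by blast+
    have "blinfun_apply M w = w"
      using M oM range_orthogonal_projection by blast
    then have "blinfun_apply P x - blinfun_apply M x
        = (blinfun_apply P x - w) - blinfun_apply M (blinfun_apply P x - w)"
      by (simp add: blinfun.diff_right proj_le_comp2[OF oM oP le[OF M(1)]])
    also have "norm \<dots> \<le> norm (blinfun_apply P x - w)"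
      by (rule norm_diff_projection_le[OF oM])
    also have "\<dots> < e"
      using w by (simp add: dist_norm norm_minus_commute)
    finally show ?thesis
      using M(1) by blast
  qed
  with P(1) le show ?thesis
    using that by blast
qed

text \<open>
  Along a descending chain the numbers \<open>norm (M x)\<close> decrease, and a sequence in the chain along
  which they approach their infimum gives a Cauchy sequence of vectors \<open>M x\<close>, since squared
  distances are differences of squared norms. Its limit belongs to all ranges, hence is the value
  of the infimum at \<open>x\<close>.
\<close>
lemma nest_Inf:
  fixes N :: "('a::complex_hilbert_space \<Rightarrow>\<^sub>L 'a) set"
  assumes N: "nest N" and S: "S \<subseteq> N" "S \<noteq> {}"
  obtains P where "P \<in> N" "\<And>M. M \<in> S \<Longrightarrow> proj_le P M"
    "\<And>x e. e > 0 \<Longrightarrow> \<exists>M\<in>S. norm (blinfun_apply P x - blinfun_apply M x) < e"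
proof -
  obtain P where P: "P \<in> N" "range (blinfun_apply P) = (\<Inter>Q\<in>S. range (blinfun_apply Q))"
    using N S unfolding nest_def by meson
  have oP: "orthogonal_projection P"
    using P N nest_projection by blast
  have oS: "orthogonal_projection M" if "M \<in> S" for M
    using that S N nest_projection by blast
  have total: "proj_le A B \<or> proj_le B A" if "A \<in> S" "B \<in> S" for A B
    using nest_total[OF N] that S(1) by blast
  have le: "proj_le P M" if "M \<in> S" for M
    using that unfolding proj_le_def P(2) by blast
  have "\<exists>M\<in>S. norm (blinfun_apply P x - blinfun_apply M x) < e" if "e > 0" for x e
  proof -
    define g where "g = (\<lambda>M :: 'a \<Rightarrow>\<^sub>L 'a. (norm (blinfun_apply M x))\<^sup>2)"
    define t where "t = Inf (g ` S)"
    have bdd: "bdd_below (g ` S)"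
      unfolding g_def by (rule bdd_belowI[of _ 0]) auto
    have t_le: "t \<le> g M" if "M \<in> S" for M
      unfolding t_def using bdd that by (intro cInf_lower) auto
    have "\<exists>M\<in>S. g M < t + 1 / real (Suc n)" for n
      using cInf_lessD[of "g ` S" "t + 1 / real (Suc n)"] S(2) unfolding t_def[symmetric] by auto
    then obtain M where MS: "\<And>n. M n \<in> S" and gM: "\<And>n. g (M n) < t + 1 / real (Suc n)"
      by metis
    have diff: "(norm (blinfun_apply A x - blinfun_apply B x))\<^sup>2 = \<bar>g A - g B\<bar>"
      if "A \<in> S" "B \<in> S" for A B
      unfolding g_def by (intro nest_norm_diff[OF N] subsetD[OF S(1)] that)
    have close: "(norm (blinfun_apply (M m) x - blinfun_apply (M n) x))\<^sup>2 < 1 / real (Suc k)"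
      if "k \<le> m" "k \<le> n" for m n k
    proof -
      have "1 / real (Suc m) \<le> 1 / real (Suc k)" "1 / real (Suc n) \<le> 1 / real (Suc k)"
        using that by (auto intro: divide_left_mono)
      then show ?thesis
        unfolding diff[OF MS MS]
        using gM[of m] gM[of n] t_le[OF MS[of m]] t_le[OF MS[of n]] by linarith
    qed
    have small: "\<exists>k. 1 / real (Suc k) < d\<^sup>2" if "d > 0" for d :: real
      using that nat_approx_posE[of "d\<^sup>2"] by (metis zero_less_power)
    have "Cauchy (\<lambda>n. blinfun_apply (M n) x)"
    proof (rule metric_CauchyI)
      fix d :: real assume "d > 0"
      then obtain k where k: "1 / real (Suc k) < d\<^sup>2"
        using small by blast
      have "dist (blinfun_apply (M m) x) (blinfun_apply (M n) x) < d" if "k \<le> m" "k \<le> n" for m n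
        unfolding dist_norm
        by (rule power_less_imp_less_base[of _ 2])
          (use close[OF that] k \<open>d > 0\<close> in linarith, use \<open>d > 0\<close> in simp)
      then show "\<exists>k. \<forall>m\<ge>k. \<forall>n\<ge>k. dist (blinfun_apply (M m) x) (blinfun_apply (M n) x) < d"
        by blast
    qed
    then obtain w where w: "(\<lambda>n. blinfun_apply (M n) x) \<longlonglongrightarrow> w"
      using Cauchy_convergent_iff convergent_def by blast
    have "w \<in> range (blinfun_apply A)" if A: "A \<in> S" for A
    proof -
      define r where "r = (\<lambda>n. blinfun_apply A (blinfun_apply (M n) x) - blinfun_apply (M n) x)"
      have "(norm (r n))\<^sup>2 \<le> 1 / real (Suc n)" for n
      proof -
        consider "proj_le (M n) A" | "proj_le A (M n)"
          using total[OF A MS[of n]] by blast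
        then show ?thesis
        proof cases
          case 1
          then show ?thesis
            by (simp add: r_def proj_le_comp1[OF oS[OF A]])
        next
          case 2
          then have "(norm (r n))\<^sup>2 = \<bar>g A - g (M n)\<bar>"
            unfolding r_def proj_le_comp2[OF oS[OF A] oS[OF MS] 2] by (intro diff A MS)
          moreover have "g A \<le> g (M n)"
            unfolding g_def using 2 by (intro power_mono proj_le_norm_le oS A MS) auto
          ultimately show ?thesis
            using gM[of n] t_le[OF A] by linarith
        qed
      qed
      moreover have "(\<lambda>n. 1 / real (Suc n)) \<longlonglongrightarrow> 0"
        by (intro LIMSEQ_Suc[OF lim_1_over_n])
      ultimately have "(\<lambda>n. (norm (r n))\<^sup>2) \<longlonglongrightarrow> 0"
        using tendsto_sandwich[of "\<lambda>_. 0" "\<lambda>n. (norm (r n))\<^sup>2" sequentially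
            "\<lambda>n. 1 / real (Suc n)" 0] by simp
      moreover have "r \<longlonglongrightarrow> blinfun_apply A w - w"
        unfolding r_def by (intro tendsto_diff blinfun.tendsto tendsto_const w)
      then have "(\<lambda>n. (norm (r n))\<^sup>2) \<longlonglongrightarrow> (norm (blinfun_apply A w - w))\<^sup>2"
        by (intro tendsto_intros)
      ultimately have "(norm (blinfun_apply A w - w))\<^sup>2 = 0"
        using LIMSEQ_unique by blast
      then show ?thesis
        by (simp add: range_orthogonal_projection[OF oS[OF A]])
    qed
    then have "blinfun_apply P w = w"
      using P(2) range_orthogonal_projection[OF oP] by blast
    moreover have "(\<lambda>n. blinfun_apply P (blinfun_apply (M n) x)) \<longlonglongrightarrow> blinfun_apply P w"
      by (intro blinfun.tendsto tendsto_const w)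
    then have "(\<lambda>n. blinfun_apply P x) \<longlonglongrightarrow> blinfun_apply P w"
      by (simp add: proj_le_comp2[OF oP oS[OF MS] le[OF MS]])
    then have "blinfun_apply P w = blinfun_apply P x"
      using LIMSEQ_unique tendsto_const by blast
    ultimately have "(\<lambda>n. blinfun_apply (M n) x) \<longlonglongrightarrow> blinfun_apply P x"
      using w by simp
    from metric_LIMSEQ_D[OF this \<open>e > 0\<close>] obtain n where
        "dist (blinfun_apply (M n) x) (blinfun_apply P x) < e"
      by blast
    then show ?thesis
      using MS by (auto simp: dist_norm norm_minus_commute)
  qed
  with P(1) le show ?thesis
    using that by blast
qed

section \<open>Gaps of a nest and factorable pairs\<close>

definition nest_gap ::
    "('a::complex_hilbert_space \<Rightarrow>\<^sub>L 'a) set \<Rightarrow> ('a \<Rightarrow>\<^sub>L 'a) \<Rightarrow> ('a \<Rightarrow>\<^sub>L 'a) \<Rightarrow> bool"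
  where "nest_gap N P Q \<longleftrightarrow> P \<in> N \<and> Q \<in> N \<and> proj_le P Q \<and> P \<noteq> Q \<and>
    (\<forall>M\<in>N. proj_le M P \<or> proj_le Q M)"

definition gapless :: "('a::complex_hilbert_space \<Rightarrow>\<^sub>L 'a) set \<Rightarrow> 'a \<Rightarrow> bool"
  where "gapless N z \<longleftrightarrow> (\<forall>P Q. nest_gap N P Q \<longrightarrow> blinfun_apply P z = blinfun_apply Q z)"

text \<open>
  An intermediate value theorem: the supremum of the projections with norm at most \<open>t\<close> at \<open>z\<close> and
  the infimum of those with norm at least \<open>t\<close> again have this property; if neither had norm
  exactly \<open>t\<close> at \<open>z\<close>, they would bound a gap, across which \<open>z\<close> does not change.
\<close>
lemma gapless_intermediate_value:
  fixes N :: "('a::complex_hilbert_space \<Rightarrow>\<^sub>L 'a) set"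
  assumes N: "nest N" and z: "gapless N z" and t: "0 \<le> t" "t \<le> norm z"
  shows "\<exists>M\<in>N. norm (blinfun_apply M z) = t"
proof (rule ccontr)
  assume contra: "\<not> ?thesis"
  define S where "S = {M \<in> N. norm (blinfun_apply M z) \<le> t}"
  define T where "T = {M \<in> N. t \<le> norm (blinfun_apply M z)}"
  have S: "S \<subseteq> N" "S \<noteq> {}" and T: "T \<subseteq> N" "T \<noteq> {}"
    using nest_zero[OF N] nest_id[OF N] t by (auto simp: S_def T_def)
  obtain P where P: "P \<in> N" "\<And>M. M \<in> S \<Longrightarrow> proj_le M P"
      "\<And>x e. e > 0 \<Longrightarrow> \<exists>M\<in>S. norm (blinfun_apply P x - blinfun_apply M x) < e"
    using nest_Sup[OF N S] by blast
  obtain Q where Q: "Q \<in> N" "\<And>M. M \<in> T \<Longrightarrow> proj_le Q M"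
      "\<And>x e. e > 0 \<Longrightarrow> \<exists>M\<in>T. norm (blinfun_apply Q x - blinfun_apply M x) < e"
    using nest_Inf[OF N T] by blast
  have "norm (blinfun_apply P z) \<le> t"
  proof (rule field_le_epsilon)
    fix e :: real assume "e > 0"
    then obtain M where M: "M \<in> S" "norm (blinfun_apply P z - blinfun_apply M z) < e"
      using P(3) by blast
    then have "norm (blinfun_apply M z) \<le> t"
      by (simp add: S_def)
    then show "norm (blinfun_apply P z) \<le> t + e"
      using M(2) norm_triangle_ineq2[of "blinfun_apply P z" "blinfun_apply M z"] by linarith
  qed
  then have P_le: "norm (blinfun_apply P z) < t"
    using contra P(1) by (metis order_le_less)
  have "t \<le> norm (blinfun_apply Q z)"
  proof (rule field_le_epsilon)
    fix e :: real assume "e > 0"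
    then obtain M where M: "M \<in> T" "norm (blinfun_apply Q z - blinfun_apply M z) < e"
      using Q(3) by blast
    then have "t \<le> norm (blinfun_apply M z)"
      by (simp add: T_def)
    then show "t \<le> norm (blinfun_apply Q z) + e"
      using M(2) norm_triangle_ineq3[of "blinfun_apply Q z" "blinfun_apply M z"] by linarith
  qed
  then have Q_ge: "t < norm (blinfun_apply Q z)"
    using contra Q(1) by (metis order_le_less)
  have "proj_le P Q"
    using nest_total[OF N P(1) Q(1)] proj_le_norm_le[of Q P z] nest_projection[OF N] P(1) Q(1)
      P_le Q_ge by fastforce
  moreover have "proj_le M P \<or> proj_le Q M" if "M \<in> N" for M
    using that P(2)[of M] Q(2)[of M] unfolding S_def T_def by (cases "norm (blinfun_apply M z) \<le> t") auto
  ultimately have "nest_gap N P Q"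
    using P(1) Q(1) P_le Q_ge unfolding nest_gap_def by force
  then show False
    using z P_le Q_ge by (auto simp: gapless_def)
qed

text \<open>
  A strict step from \<open>P\<close> to \<open>Q\<close> leaves room for a unit vector \<open>y\<close> between their images under a
  nest isomorphism, and the two conditions on \<open>M\<close> are what puts \<open>|a\<rangle>\<langle>y|\<close> and \<open>|y\<rangle>\<langle>b|\<close>
  into the two operator spaces. Their product is \<open>|a\<rangle>\<langle>b|\<close>.
\<close>
definition factorable_pair ::
    "('a::complex_hilbert_space \<Rightarrow>\<^sub>L 'a) set \<Rightarrow> 'a \<times> 'a \<Rightarrow> bool"
  where "factorable_pair N p \<longleftrightarrow> (\<exists>P\<in>N. \<exists>Q\<in>N. proj_le P Q \<and> P \<noteq> Q \<and>
    (\<forall>M\<in>N. (blinfun_apply M (fst p) = fst p \<or> proj_le M P) \<and>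
      (blinfun_apply M (snd p) = 0 \<or> proj_le Q M)))"

lemma projection_fixed_mono:
  assumes "orthogonal_projection Q" "proj_le P Q" "blinfun_apply P x = x"
  shows "blinfun_apply Q x = x"
  by (metis assms proj_le_comp1)

lemma projection_zero_mono:
  assumes "orthogonal_projection P" "orthogonal_projection Q" "proj_le P Q" "blinfun_apply Q x = 0"
  shows "blinfun_apply P x = 0"
  by (metis assms proj_le_comp2 blinfun.zero_right)

text \<open>
  There are two sources of factorable pairs: vectors separated by a strict step of the nest, and
  vectors on the two sides of one gap, which may coincide.
\<close>
lemma factorable_pair_separated:
  assumes N: "nest N" and PQ: "P \<in> N" "Q \<in> N" "proj_le P Q" "P \<noteq> Q"
    and ab: "blinfun_apply P a = a" "blinfun_apply Q b = 0"
  shows "factorable_pair N (a, b)"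
  unfolding factorable_pair_def
proof (rule bexI[of _ P], rule bexI[of _ Q], intro conjI ballI)
  fix M assume M: "M \<in> N"
  show "blinfun_apply M (fst (a, b)) = fst (a, b) \<or> proj_le M P"
    using nest_total[OF N M PQ(1)] projection_fixed_mono[of M P a] nest_projection[OF N M] ab
    by auto
  show "blinfun_apply M (snd (a, b)) = 0 \<or> proj_le Q M"
    using nest_total[OF N M PQ(2)] projection_zero_mono[of M Q b] nest_projection[OF N] M PQ ab
    by auto
qed (use PQ in auto)

lemma factorable_pair_gap:
  assumes N: "nest N" and gap: "nest_gap N P Q"
    and ab: "blinfun_apply Q a = a" "blinfun_apply P b = 0"
  shows "factorable_pair N (a, b)"
  unfolding factorable_pair_def
proof (rule bexI[of _ P], rule bexI[of _ Q], intro conjI ballI)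
  fix M assume M: "M \<in> N"
  then have PQM: "proj_le M P \<or> proj_le Q M" and PN: "P \<in> N"
    using gap by (auto simp: nest_gap_def)
  show "blinfun_apply M (fst (a, b)) = fst (a, b) \<or> proj_le M P"
    using PQM projection_fixed_mono[of M Q a] nest_projection[OF N M] ab by auto
  show "blinfun_apply M (snd (a, b)) = 0 \<or> proj_le Q M"
    using PQM projection_zero_mono[of M P b] nest_projection[OF N] M PN ab by auto
qed (use gap in \<open>auto simp: nest_gap_def\<close>)

lemma unit_vector_between_projections:
  assumes P: "orthogonal_projection P" and Q: "orthogonal_projection Q"
    and "proj_le P Q" "P \<noteq> Q"
  obtains y where "norm y = 1" "blinfun_apply Q y = y" "blinfun_apply P y = 0"
proof -
  obtain x where x: "blinfun_apply Q x \<noteq> blinfun_apply P x"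
    using assms(4) blinfun_eqI by metis
  define w where "w = blinfun_apply Q x - blinfun_apply P x"
  have "blinfun_apply Q w = w" "blinfun_apply P w = 0"
    by (simp_all add: w_def blinfun.diff_right orthogonal_projection_idem[OF P]
        orthogonal_projection_idem[OF Q] proj_le_comp1[OF Q assms(3)] proj_le_comp2[OF P Q assms(3)])
  moreover have "w \<noteq> 0"
    using x by (simp add: w_def)
  ultimately show ?thesis
    by (intro that[of "sgn w"]) (auto simp: norm_sgn sgn_div_norm blinfun.scaleR_right)
qed

lemma factorable_pair_factors:
  fixes N1 :: "('a::complex_hilbert_space \<Rightarrow>\<^sub>L 'a) set" and N2 :: "('b::complex_hilbert_space \<Rightarrow>\<^sub>L 'b) set"
  assumes N1: "nest N1" and N2: "nest N2" and iso: "nest_isomorphism N1 N2 \<theta>"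
    and p: "factorable_pair N1 p"
  shows "\<exists>y. norm y = 1 \<and> rank_one (fst p) y \<in> compact_part (Op_nest_inv N1 \<theta>) \<and>
    rank_one y (snd p) \<in> compact_part (Op_nest N1 \<theta>)"
proof -
  obtain P Q where PQ: "P \<in> N1" "Q \<in> N1" "proj_le P Q" "P \<noteq> Q"
    and a: "\<And>M. M \<in> N1 \<Longrightarrow> blinfun_apply M (fst p) = fst p \<or> proj_le M P"
    and b: "\<And>M. M \<in> N1 \<Longrightarrow> blinfun_apply M (snd p) = 0 \<or> proj_le Q M"
    using p unfolding factorable_pair_def by blast
  have mono: "proj_le (\<theta> A) (\<theta> B)" if "A \<in> N1" "B \<in> N1" "proj_le A B" for A B
    using iso that by (auto simp: nest_isomorphism_def monotone_on_def)
  have proj1: "orthogonal_projection M" and proj2: "orthogonal_projection (\<theta> M)"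
    if "M \<in> N1" for M
    using that iso nest_projection[OF N1] nest_projection[OF N2]
    by (auto simp: nest_isomorphism_def bij_betw_def)
  have "\<theta> P \<noteq> \<theta> Q"
    using iso PQ by (auto simp: nest_isomorphism_def bij_betw_def inj_on_def)
  then obtain y where y: "norm y = 1" "blinfun_apply (\<theta> Q) y = y" "blinfun_apply (\<theta> P) y = 0"
    using unit_vector_between_projections[OF proj2 proj2 mono] PQ by blast
  have "(id_blinfun - M) o\<^sub>L rank_one (fst p) y o\<^sub>L \<theta> M = 0" if M: "M \<in> N1" for M
    using a[OF M]
  proof
    assume "proj_le M P"
    then have "blinfun_apply (\<theta> M) y = 0"
      using projection_zero_mono[OF proj2 proj2 mono] M PQ y(3) by blast
    then show ?thesis
      by (intro blinfun_eqI) (simp add: orthogonal_projection_adjoint[OF proj2[OF M]])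
  qed (intro blinfun_eqI, simp add: blinfun.diff_left orthogonal_projection_scaleC[OF proj1[OF M]])
  moreover have "(id_blinfun - \<theta> M) o\<^sub>L rank_one y (snd p) o\<^sub>L M = 0" if M: "M \<in> N1" for M
    using b[OF M]
  proof
    assume "proj_le Q M"
    then have "blinfun_apply (\<theta> M) y = y"
      using projection_fixed_mono[OF proj2 mono] M PQ y(2) by blast
    then show ?thesis
      by (intro blinfun_eqI) (simp add: blinfun.diff_left orthogonal_projection_scaleC[OF proj2[OF M]])
  qed (intro blinfun_eqI, simp add: orthogonal_projection_adjoint[OF proj1[OF M]])
  ultimately show ?thesis
    using y(1) by (intro exI[of _ y])
      (simp add: compact_part_def Op_nest_def Op_nest_inv_def rank_one_clinear compact_operator_rank_one)
qed

section \<open>Approximating the identity on a cyclic subspace\<close>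

definition cyclic_span ::
    "('a::complex_hilbert_space \<Rightarrow>\<^sub>L 'a) set \<Rightarrow> 'a \<Rightarrow> 'a set"
  where "cyclic_span N z = cspan ((\<lambda>M. blinfun_apply M z) ` N)"

lemma cyclic_span_base: "M \<in> N \<Longrightarrow> blinfun_apply M z \<in> cyclic_span N z"
  unfolding cyclic_span_def by (rule subsetD[OF cspan_superset imageI])

lemma cyclic_span_orthogonal:
  assumes N: "nest N" and orth: "\<And>M. M \<in> N \<Longrightarrow> cinner (blinfun_apply M z) z' = 0"
    and "x \<in> cyclic_span N z" "y \<in> cyclic_span N z'"
  shows "cinner x y = 0"
proof (rule cspan_orthogonal[OF _ assms(3)[unfolded cyclic_span_def] assms(4)[unfolded cyclic_span_def]])
  fix x y assume "x \<in> (\<lambda>M. blinfun_apply M z) ` N" "y \<in> (\<lambda>M. blinfun_apply M z') ` N"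
  then obtain A B where AB: "A \<in> N" "B \<in> N" "x = blinfun_apply A z" "y = blinfun_apply B z'"
    by blast
  have "cinner x y = cinner (blinfun_apply (B o\<^sub>L A) z) z'"
    using AB by (simp add: orthogonal_projection_adjoint[OF nest_projection[OF N]])
  also have "\<dots> = 0"
    using nest_comp_mem[OF N AB(2,1)] orth AB(1,2) by metis
  finally show "cinner x y = 0" .
qed

text \<open>
  The intermediate value theorem divides \<open>z\<close> into \<open>n\<close> orthogonal pieces of equal norm along a
  chain \<open>R 0, \<dots>, R n\<close>, and the partial isometry shifts these pieces downwards by two places. The
  shift by two places leaves a nontrivial step of the chain between the two vectors of each pair,
  as factoring demands. Since the pieces have equal norm, the shift moves \<open>R j z\<close> to \<open>R (j - 2) z\<close>,
  which is close to \<open>R j z\<close>.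
\<close>
lemma gapless_shift:
  fixes N :: "('a::complex_hilbert_space \<Rightarrow>\<^sub>L 'a) set"
  assumes N: "nest N" and z: "gapless N z" "norm z = 1" and n: "0 < n"
  shows "\<exists>S. orthonormal_pairs S \<and>
    (\<forall>p\<in>S. factorable_pair N p \<and> fst p \<in> cyclic_span N z \<and> snd p \<in> cyclic_span N z) \<and>
    (\<forall>M\<in>N. norm (blinfun_apply (pair_isometry S) (blinfun_apply M z) - blinfun_apply M z)
      \<le> 4 / sqrt (real n))"
proof -
  have "\<exists>M\<in>N. norm (blinfun_apply M z) = sqrt (real i / real n)" if "i \<le> n" for i
    using that n z(2) by (intro gapless_intermediate_value[OF N z(1)]) auto
  then obtain R where RN: "\<And>i. i \<le> n \<Longrightarrow> R i \<in> N"
    and normR: "\<And>i. i \<le> n \<Longrightarrow> norm (blinfun_apply (R i) z) = sqrt (real i / real n)"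
    by metis
  have normR2: "(norm (blinfun_apply (R i) z))\<^sup>2 = real i / real n" if "i \<le> n" for i
    using normR[OF that] by simp
  have oR: "orthogonal_projection (R i)" if "i \<le> n" for i
    using nest_projection[OF N RN[OF that]] .
  have R_neq: "R i \<noteq> R j" if "i < j" "j \<le> n" for i j
  proof
    assume "R i = R j"
    then have "real i / real n = real j / real n"
      using normR2[of i] normR2[of j] that by simp
    then show False
      using n that by simp
  qed
  have R_le: "proj_le (R i) (R j)" if "i \<le> j" "j \<le> n" for i j
  proof (rule ccontr)
    assume not_le: "\<not> ?thesis"
    then have "proj_le (R j) (R i)" "i < j"
      using nest_total[OF N RN RN, of i j] that proj_le_refl by (auto simp: order_le_less)
    then have "(norm (blinfun_apply (R j) z))\<^sup>2 \<le> (norm (blinfun_apply (R i) z))\<^sup>2"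
      using that by (intro power_mono proj_le_norm_le oR) auto
    then have "real j / real n \<le> real i / real n"
      using that by (simp add: normR2)
    then show False
      using n \<open>i < j\<close> by (simp add: divide_le_cancel)
  qed
  define s where "s = sqrt (real n)"
  have s: "s > 0" "s * s = real n" "s\<^sup>2 = real n"
    using n by (simp_all add: s_def)
  define e where "e = (\<lambda>i. s *\<^sub>R (blinfun_apply (R (Suc i)) z - blinfun_apply (R i) z))"
  have norm_e: "norm (e i) = 1" if "i < n" for i
  proof -
    have "(norm (blinfun_apply (R (Suc i)) z - blinfun_apply (R i) z))\<^sup>2 = 1 / real n"
      using proj_le_norm_diff[OF oR oR R_le, of i "Suc i" z] that
      by (simp add: normR2 add_divide_distrib)
    then have "(norm (e i))\<^sup>2 = 1"
      using s n by (simp add: e_def power_mult_distrib)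
    then show ?thesis
      by (simp add: power2_eq_1_iff) (use norm_ge_zero[of "e i"] in linarith)
  qed
  have R_fix: "blinfun_apply (R j) (e i) = e i" if "i < j" "j \<le> n" for i j
    using that by (simp add: e_def blinfun.scaleR_right blinfun.diff_right
        proj_le_comp1[OF oR R_le] del: scaleR_right_diff_distrib)
  have R_kill: "blinfun_apply (R j) (e i) = 0" if "j \<le> i" "i < n" for i j
    using that by (simp add: e_def blinfun.scaleR_right blinfun.diff_right
        proj_le_comp2[OF oR oR R_le])
  have orth_less: "cinner (e i) (e j) = 0" if "i < j" "j < n" for i j
  proof -
    have "cinner (e i) (e j) = cinner (blinfun_apply (R j) (e i)) (e j)"
      using that by (simp add: R_fix)
    also have "\<dots> = 0"
      using that by (simp add: orthogonal_projection_adjoint[OF oR] R_kill)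
    finally show ?thesis .
  qed
  have orth: "cinner (e i) (e j) = 0" if "i \<noteq> j" "i < n" "j < n" for i j
    using orth_less[of i j] orth_less[of j i] cinner_eq_zero_commute[of "e i" "e j"] that
    by (cases "i < j") auto
  have e_cyc: "e i \<in> cyclic_span N z" if "i < n" for i
    unfolding e_def cyclic_span_def using that
    by (intro csubspace_scaleR csubspace_diff csubspace_cspan subsetD[OF cspan_superset] imageI RN) auto
  have coeff: "cinner (blinfun_apply (R j) z) (e k) = (if k < j then of_real (1 / s) else 0)"
    if "j \<le> n" "k < n" for j k
  proof (cases "k < j")
    case True
    have self: "cinner z (blinfun_apply (R i) z) = of_real (real i / real n)" if "i \<le> n" for i
    proof -
      have "cinner z (blinfun_apply (R i) z)
          = cinner (blinfun_apply (R i) z) (blinfun_apply (R i) z)"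
        by (simp add: orthogonal_projection_adjoint[OF oR[OF that]]
            orthogonal_projection_idem[OF oR[OF that]])
      then show ?thesis
        unfolding cinner_self normR2[OF that] .
    qed
    have "cinner (blinfun_apply (R j) z) (e k) = cinner z (e k)"
      using that True by (simp add: orthogonal_projection_adjoint[OF oR] R_fix)
    also have "\<dots> = of_real (s * (real (Suc k) / real n - real k / real n))"
      using that True unfolding e_def cinner_scaleR_right cinner_diff_right
      by (simp only: self Suc_leI less_imp_le of_real_mult of_real_diff)
    also have "s * (real (Suc k) / real n - real k / real n) = 1 / s"
      using s n by (simp add: diff_divide_distrib[symmetric] field_simps)
    finally show ?thesis
      using True by simp
  next
    case False
    with that show ?thesis
      by (simp add: orthogonal_projection_adjoint[OF oR] R_kill)
  qed
  define S where "S = (\<lambda>i. (e i, e (i + 2))) ` {..<n - 2}"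
  have inj: "inj_on (\<lambda>i. (e i, e (i + 2))) {..<n - 2}"
  proof (rule inj_onI)
    fix i j assume *: "i \<in> {..<n - 2}" "j \<in> {..<n - 2}" "(e i, e (i + 2)) = (e j, e (j + 2))"
    then have "cinner (e i) (e j) = 1"
      using norm_e[of j] by (simp add: cinner_self)
    then show "i = j"
      using orth[of i j] * by fastforce
  qed
  have "orthonormal_pairs S"
    unfolding orthonormal_pairs_def S_def by (auto intro!: orth norm_e)
  moreover have "factorable_pair N (e i, e (i + 2))" if "i + 2 < n" for i
    using that by (intro factorable_pair_separated[OF N RN[of "i + 1"] RN[of "i + 2"]] R_le R_neq)
      (auto intro: R_fix R_kill)
  then have "\<forall>p\<in>S. factorable_pair N p \<and> fst p \<in> cyclic_span N z \<and> snd p \<in> cyclic_span N z"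
    unfolding S_def using e_cyc by auto
  moreover have "norm (blinfun_apply (pair_isometry S) (blinfun_apply M z) - blinfun_apply M z)
      \<le> 4 / sqrt (real n)" if M: "M \<in> N" for M
  proof -
    define T where "T = blinfun_apply (pair_isometry S)"
    have T_R: "T (blinfun_apply (R j) z) = blinfun_apply (R (j - 2)) z" if j: "j \<le> n" for j
    proof -
      have "T (blinfun_apply (R j) z)
          = (\<Sum>i<n - 2. cinner (blinfun_apply (R j) z) (e (i + 2)) *\<^sub>C e i)"
        unfolding T_def pair_isometry_apply S_def by (subst sum.reindex[OF inj]) simp
      also have "\<dots> = (\<Sum>i<n - 2. if i < j - 2 then (1 / s) *\<^sub>R e i else 0)"
        using j by (intro sum.cong) (auto simp: coeff scaleC_of_real simp del: of_real_divide)
      also have "\<dots> = (\<Sum>i<j - 2. (1 / s) *\<^sub>R e i)"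
        using j by (intro sum.mono_neutral_cong_right) auto
      also have "\<dots> = (\<Sum>i<j - 2. blinfun_apply (R (Suc i)) z - blinfun_apply (R i) z)"
        using s by (simp add: e_def)
      also have "\<dots> = blinfun_apply (R (j - 2)) z - blinfun_apply (R 0) z"
        by (rule sum_lessThan_telescope)
      also have "blinfun_apply (R 0) z = 0"
        using normR[of 0] by simp
      finally show ?thesis
        by simp
    qed
    define m where "m = (norm (blinfun_apply M z))\<^sup>2"
    have m: "0 \<le> m" "m \<le> 1"
      using norm_projection_le[OF nest_projection[OF N M], of z] z(2)
      by (auto simp: m_def power_le_one)
    \<comment> \<open>the member of the chain next below \<open>M\<close> as measured by the norm at \<open>z\<close>\<close>
    define j where "j = nat \<lfloor>real n * m\<rfloor>"
    have j: "real j \<le> real n * m" "real n * m < real j + 1"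
      using m by (simp_all add: j_def)
    have "real n * m \<le> real n * 1"
      using m by (intro mult_left_mono) auto
    then have jn: "j \<le> n"
      using j by linarith
    have "(norm (blinfun_apply M z - blinfun_apply (R j) z))\<^sup>2 = \<bar>m - real j / real n\<bar>"
      using nest_norm_diff[OF N M RN[OF jn], of z] normR2[OF jn] by (simp add: m_def)
    also have "\<dots> \<le> 1 / real n"
    proof -
      have "real j / real n \<le> m"
        using j(1) n by (simp add: pos_divide_le_eq mult.commute)
      moreover have "m < (real j + 1) / real n"
        using j(2) n by (simp add: pos_less_divide_eq mult.commute)
      ultimately show ?thesis
        by (simp add: add_divide_distrib)
    qed
    also have "1 / real n = (1 / s)\<^sup>2"
      using s by (simp add: power2_eq_square)
    finally have near: "norm (blinfun_apply M z - blinfun_apply (R j) z) \<le> 1 / s"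
      by (rule power2_le_imp_le) (use s in simp)
    have "(norm (blinfun_apply (R j) z - blinfun_apply (R (j - 2)) z))\<^sup>2
        = real j / real n - real (j - 2) / real n"
      using proj_le_norm_diff[OF oR oR R_le, of "j - 2" j z] jn by (simp add: normR2)
    also have "\<dots> \<le> 2 / real n"
      unfolding diff_divide_distrib[symmetric] by (intro divide_right_mono) auto
    also have "\<dots> \<le> (2 / s)\<^sup>2"
      using s n by (simp add: power2_eq_square field_simps)
    finally have step: "norm (blinfun_apply (R j) z - blinfun_apply (R (j - 2)) z) \<le> 2 / s"
      by (rule power2_le_imp_le) (use s in simp)
    have "norm (T (blinfun_apply M z) - T (blinfun_apply (R j) z)) \<le> 1 / s"
      using pair_isometry_contraction[OF \<open>orthonormal_pairs S\<close>] near order_trans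
      unfolding T_def blinfun.diff_right[symmetric] by blast
    moreover have "T (blinfun_apply M z) - blinfun_apply M z
        = (T (blinfun_apply M z) - T (blinfun_apply (R j) z))
          - (blinfun_apply (R j) z - blinfun_apply (R (j - 2)) z)
          - (blinfun_apply M z - blinfun_apply (R j) z)"
      by (simp add: T_R[OF jn])
    ultimately have "norm (T (blinfun_apply M z) - blinfun_apply M z) \<le> 1 / s + 2 / s + 1 / s"
      using near step by (metis add_mono norm_triangle_le_diff)
    then show ?thesis
      by (simp add: T_def s_def)
  qed
  ultimately show ?thesis
    by blast
qed

text \<open>
  For both kinds of vector the identity on the cyclic subspace is a strong limit of partial
  isometries made of factorable pairs: the rank one projection onto a unit vector in a gap is one
  itself, and a gapless vector is shifted.
\<close>
definition homogeneous_vector ::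
    "('a::complex_hilbert_space \<Rightarrow>\<^sub>L 'a) set \<Rightarrow> 'a \<Rightarrow> bool"
  where "homogeneous_vector N z \<longleftrightarrow> gapless N z \<or>
    (\<exists>P Q. nest_gap N P Q \<and> blinfun_apply Q z = z \<and> blinfun_apply P z = 0)"

lemma homogeneous_vector_approximation:
  fixes N :: "('a::complex_hilbert_space \<Rightarrow>\<^sub>L 'a) set"
  assumes N: "nest N" and z: "homogeneous_vector N z" "norm z = 1"
  shows "\<exists>S :: nat \<Rightarrow> ('a \<times> 'a) set. (\<forall>n. orthonormal_pairs (S n) \<and>
      (\<forall>p\<in>S n. factorable_pair N p \<and> fst p \<in> cyclic_span N z \<and> snd p \<in> cyclic_span N z)) \<and>
    (\<forall>M\<in>N. (\<lambda>n. blinfun_apply (pair_isometry (S n)) (blinfun_apply M z)) \<longlonglongrightarrow> blinfun_apply M z)"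
  using z(1) unfolding homogeneous_vector_def
proof (elim disjE exE conjE)
  assume "gapless N z"
  have "\<forall>n. \<exists>S. orthonormal_pairs S \<and>
    (\<forall>p\<in>S. factorable_pair N p \<and> fst p \<in> cyclic_span N z \<and> snd p \<in> cyclic_span N z) \<and>
    (\<forall>M\<in>N. norm (blinfun_apply (pair_isometry S) (blinfun_apply M z) - blinfun_apply M z)
      \<le> 4 / sqrt (real (Suc n)))"
    by (intro allI gapless_shift[OF N \<open>gapless N z\<close> z(2)]) simp
  from choice[OF this] obtain S where S: "\<And>n. orthonormal_pairs (S n)"
      "\<And>n. \<forall>p\<in>S n. factorable_pair N p \<and> fst p \<in> cyclic_span N z \<and> snd p \<in> cyclic_span N z"
      "\<And>n M. M \<in> N \<Longrightarrow> norm (blinfun_apply (pair_isometry (S n)) (blinfun_apply M z)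
        - blinfun_apply M z) \<le> 4 / sqrt (real (Suc n))"
    by blast
  have "(\<lambda>n. blinfun_apply (pair_isometry (S n)) (blinfun_apply M z)) \<longlonglongrightarrow> blinfun_apply M z"
    if "M \<in> N" for M
  proof -
    have "(\<lambda>n. 4 / sqrt (real (Suc n))) \<longlonglongrightarrow> 0"
      by (intro tendsto_divide_0[OF tendsto_const] filterlim_at_top_imp_at_infinity
          filterlim_compose[OF sqrt_at_top] filterlim_compose[OF filterlim_real_sequentially]
          filterlim_Suc)
    then have "(\<lambda>n. blinfun_apply (pair_isometry (S n)) (blinfun_apply M z) - blinfun_apply M z)
        \<longlonglongrightarrow> 0"
      by (rule Lim_null_comparison[rotated]) (use S(3)[OF that] in auto)
    then show ?thesis
      by (simp add: LIM_zero_iff)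
  qed
  with S show ?thesis
    by blast
next
  fix P Q assume gap: "nest_gap N P Q" and Q: "blinfun_apply Q z = z" and P: "blinfun_apply P z = 0"
  have "blinfun_apply (pair_isometry {(z, z)}) (blinfun_apply M z) = blinfun_apply M z"
    if M: "M \<in> N" for M
  proof -
    have "proj_le M P \<or> proj_le Q M"
      using gap M by (simp add: nest_gap_def)
    then have "blinfun_apply M z = 0 \<or> blinfun_apply M z = z"
      using projection_zero_mono[of M P z] projection_fixed_mono[of M Q z] P Q
        nest_projection[OF N] M gap by (auto simp: nest_gap_def)
    then show ?thesis
      using z(2) by (auto simp: pair_isometry_apply cinner_self)
  qed
  moreover have "orthonormal_pairs {(z, z)}"
    using z(2) by (simp add: orthonormal_pairs_def)
  moreover have "factorable_pair N (z, z)"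
    by (rule factorable_pair_gap[OF N gap Q P])
  moreover have "z \<in> cyclic_span N z"
    using cyclic_span_base[OF nest_id[OF N], of z] by simp
  ultimately show ?thesis
    by (intro exI[of _ "\<lambda>_. {(z, z)}"]) auto
qed

section \<open>Decomposition into cyclic subspaces\<close>

text \<open>
  In a family that is maximal with respect to orthogonality of the cyclic subspaces, any nonzero
  vector \<open>w\<close> orthogonal to all of them would, after normalization, give a new member: its component
  in a gap where that component does not vanish, or \<open>w\<close> itself when there is no such gap.
\<close>
lemma exists_homogeneous_cyclic_decomposition:
  fixes N :: "('a::complex_hilbert_space \<Rightarrow>\<^sub>L 'a) set"
  assumes N: "nest N"
  shows "\<exists>Z. (\<forall>z\<in>Z. norm z = 1 \<and> homogeneous_vector N z) \<and>
    (\<forall>z\<in>Z. \<forall>z'\<in>Z. z \<noteq> z' \<longrightarrow> (\<forall>M\<in>N. cinner (blinfun_apply M z) z' = 0)) \<and>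
    closure (cspan {blinfun_apply M z | M z. M \<in> N \<and> z \<in> Z}) = UNIV"
proof -
  define \<Z> where "\<Z> = {Z. (\<forall>z\<in>Z. norm z = 1 \<and> homogeneous_vector N z) \<and>
    (\<forall>z\<in>Z. \<forall>z'\<in>Z. z \<noteq> z' \<longrightarrow> (\<forall>M\<in>N. cinner (blinfun_apply M z) z' = 0))}"
  have "\<exists>Z\<in>\<Z>. \<forall>X\<in>\<Z>. Z \<subseteq> X \<longrightarrow> X = Z"
  proof (rule subset_Zorn')
    fix C assume C: "subset.chain \<Z> C"
    have mem: "Z \<in> \<Z>" if "Z \<in> C" for Z
      using C that unfolding subset_chain_def by blast
    have "\<exists>Z\<in>C. z \<in> Z \<and> z' \<in> Z" if "z \<in> \<Union>C" "z' \<in> \<Union>C" for z z'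
    proof -
      obtain A B where AB: "A \<in> C" "z \<in> A" "B \<in> C" "z' \<in> B"
        using \<open>z \<in> \<Union>C\<close> \<open>z' \<in> \<Union>C\<close> by blast
      then have "A \<subseteq> B \<or> B \<subseteq> A"
        using C unfolding subset_chain_def by blast
      with AB show ?thesis
        by blast
    qed
    then have "cinner (blinfun_apply M z) z' = 0"
      if "z \<in> \<Union>C" "z' \<in> \<Union>C" "z \<noteq> z'" "M \<in> N" for z z' M
      using that mem unfolding \<Z>_def by blast
    moreover have "norm z = 1 \<and> homogeneous_vector N z" if "z \<in> \<Union>C" for z
      using that mem unfolding \<Z>_def by blast
    ultimately show "\<Union>C \<in> \<Z>"
      unfolding \<Z>_def by blast
  qed
  then obtain Z where Z: "Z \<in> \<Z>" and maximal: "\<And>X. X \<in> \<Z> \<Longrightarrow> Z \<subseteq> X \<Longrightarrow> X = Z"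
    by blast
  define G where "G = {blinfun_apply M z | M z. M \<in> N \<and> z \<in> Z}"
  \<comment> \<open>maximality forbids a further vector; normalizing it reduces to unit vectors\<close>
  have extend: False
    if w: "w \<noteq> 0" "homogeneous_vector N w"
      and orth: "\<And>M z. M \<in> N \<Longrightarrow> z \<in> Z \<Longrightarrow> cinner w (blinfun_apply M z) = 0" for w
  proof -
    define y where "y = sgn w"
    have y: "norm y = 1" "y = inverse (norm w) *\<^sub>R w"
      using w(1) by (simp_all add: y_def norm_sgn sgn_div_norm)
    have orth_y: "cinner y (blinfun_apply M z) = 0" if "M \<in> N" "z \<in> Z" for M z
      using orth[OF that] by (simp add: y(2) cinner_scaleR_left)
    have "homogeneous_vector N y"
      using w(2) unfolding homogeneous_vector_def gapless_def y(2)
      by (metis blinfun.scaleR_right scaleR_zero_right)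
    moreover have "cinner (blinfun_apply M z) y = 0" if "M \<in> N" "z \<in> Z" for M z
      using orth_y[OF that] cinner_eq_zero_commute[of y] by blast
    moreover have "cinner (blinfun_apply M y) z = 0" if "M \<in> N" "z \<in> Z" for M z
      using orth_y[OF that]
      by (simp add: orthogonal_projection_adjoint[OF nest_projection[OF N that(1)]])
    ultimately have "insert y Z \<in> \<Z>"
      using Z y(1) unfolding \<Z>_def by auto
    then have "y \<in> Z"
      using maximal[of "insert y Z"] by auto
    then have "cinner y y = 0"
      using orth_y[OF nest_id[OF N], of y] by simp
    then show False
      using y(1) by (simp add: cinner_self)
  qed
  have "closure (cspan G) = UNIV"
  proof (rule ccontr)
    assume "closure (cspan G) \<noteq> UNIV"
    then obtain w where w: "w \<noteq> 0" "\<And>y. y \<in> closure (cspan G) \<Longrightarrow> cinner w y = 0"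
      using exists_orthogonal_vector[OF csubspace_closure[OF csubspace_cspan] closed_closure] by metis
    have orth: "cinner w (blinfun_apply M z) = 0" if "M \<in> N" "z \<in> Z" for M z
    proof (rule w(2), rule subsetD[OF closure_subset], rule subsetD[OF cspan_superset])
      show "blinfun_apply M z \<in> G"
        using that unfolding G_def by blast
    qed
    show False
    proof (cases "gapless N w")
      case True
      then show False
        using extend[OF w(1) _ orth] by (simp add: homogeneous_vector_def)
    next
      case False
      then obtain P Q where gap: "nest_gap N P Q" and ne: "blinfun_apply P w \<noteq> blinfun_apply Q w"
        by (auto simp: gapless_def)
      then have PQ: "P \<in> N" "Q \<in> N" "proj_le P Q"
        by (auto simp: nest_gap_def)
      have oP: "orthogonal_projection P" and oQ: "orthogonal_projection Q"
        using nest_projection[OF N] PQ by auto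
      define x where "x = blinfun_apply Q w - blinfun_apply P w"
      have "blinfun_apply Q x = x" "blinfun_apply P x = 0"
        by (simp_all add: x_def blinfun.diff_right orthogonal_projection_idem[OF oP]
            orthogonal_projection_idem[OF oQ] proj_le_comp1[OF oQ PQ(3)] proj_le_comp2[OF oP oQ PQ(3)])
      then have "homogeneous_vector N x"
        using gap unfolding homogeneous_vector_def by blast
      moreover have "cinner (blinfun_apply A w) (blinfun_apply M z) = 0"
        if "A \<in> N" "M \<in> N" "z \<in> Z" for A M z
      proof -
        have "cinner (blinfun_apply A w) (blinfun_apply M z) = cinner w (blinfun_apply (A o\<^sub>L M) z)"
          by (simp add: orthogonal_projection_adjoint[OF nest_projection[OF N that(1)]])
        also have "\<dots> = 0"
          using nest_comp_mem[OF N that(1,2)] orth that by metis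
        finally show ?thesis .
      qed
      ultimately show False
        using extend[of x] ne PQ by (simp add: x_def cinner_diff_left)
    qed
  qed
  then show ?thesis
    using Z unfolding \<Z>_def G_def mem_Collect_eq by (intro exI[of _ Z] conjI) (elim conjE, assumption)+
qed

lemma csubspace_pointwise_convergence:
  assumes "\<And>i. f i \<in> clinear_ops"
  shows "csubspace {x. ((\<lambda>i. blinfun_apply (f i) x) \<longlongrightarrow> x) F}"
  using assms unfolding csubspace_def clinear_ops_def
  by (auto simp: blinfun.add_right intro: tendsto_add bounded_linear.tendsto[OF bounded_linear_scaleC])

lemma closed_pointwise_convergence:
  fixes f :: "'i \<Rightarrow> 'a::complex_hilbert_space \<Rightarrow>\<^sub>L 'a"
  assumes contr: "eventually (\<lambda>i. norm (f i) \<le> 1) F"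
  shows "closed {x. ((\<lambda>i. blinfun_apply (f i) x) \<longlongrightarrow> x) F}" (is "closed ?C")
proof -
  have "x \<in> ?C" if "x \<in> closure ?C" for x
  proof -
    have "eventually (\<lambda>i. dist (blinfun_apply (f i) x) x < e) F" if "e > 0" for e
    proof -
      obtain y where y: "y \<in> ?C" "dist y x < e / 3"
        using \<open>x \<in> closure ?C\<close> \<open>e > 0\<close> closure_approachable[of x ?C] by (meson divide_pos_pos zero_less_numeral)
      then have "eventually (\<lambda>i. dist (blinfun_apply (f i) y) y < e / 3) F"
        using \<open>e > 0\<close> by (auto dest: tendstoD[where e = "e / 3"])
      with contr show ?thesis
      proof eventually_elim
        case (elim i)
        have "norm (blinfun_apply (f i) (x - y)) \<le> norm (f i) * norm (x - y)"
          by (rule norm_blinfun)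
        also have "\<dots> \<le> 1 * norm (x - y)"
          by (rule mult_right_mono[OF elim(1) norm_ge_zero])
        finally have "dist (blinfun_apply (f i) x) (blinfun_apply (f i) y) < e / 3"
          using y(2) by (simp add: dist_norm blinfun.diff_right norm_minus_commute)
        with elim(2) y(2) show ?case
          using dist_triangle[of "blinfun_apply (f i) x" x "blinfun_apply (f i) y"]
            dist_triangle[of "blinfun_apply (f i) y" x y] by linarith
      qed
    qed
    then show ?thesis
      by (simp add: tendsto_iff)
  qed
  then have "closure ?C = ?C"
    using closure_subset[of ?C] by blast
  then show ?thesis
    using closed_closure[of ?C] by simp
qed

text \<open>
  The partial isometries for finitely many members of a cyclic decomposition add up to a single one,
  since distinct cyclic subspaces are orthogonal. They are indexed by a finite part of the
  decomposition together with a degree of accuracy and converge strongly to the identity along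
  the product filter: the vectors at which they do form a closed subspace that contains the
  cyclic subspaces.
\<close>
lemma nest_finite_approximation:
  fixes N :: "('a::complex_hilbert_space \<Rightarrow>\<^sub>L 'a) set"
  assumes N: "nest N" and L: "finite L"
  shows "\<exists>S. orthonormal_pairs S \<and> (\<forall>p\<in>S. factorable_pair N p) \<and>
    (\<forall>x\<in>L. norm (blinfun_apply (pair_isometry S) x - x) < 1)"
proof -
  obtain Z where Z: "\<forall>z\<in>Z. norm z = 1 \<and> homogeneous_vector N z"
    and Z_orth: "\<forall>z\<in>Z. \<forall>z'\<in>Z. z \<noteq> z' \<longrightarrow> (\<forall>M\<in>N. cinner (blinfun_apply M z) z' = 0)"
    and dense: "closure (cspan {blinfun_apply M z | M z. M \<in> N \<and> z \<in> Z}) = UNIV"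
    using exists_homogeneous_cyclic_decomposition[OF N] by (elim exE conjE) (rule that)
  have orth: "cinner (blinfun_apply M z) z' = 0"
    if "z \<in> Z" "z' \<in> Z" "z \<noteq> z'" "M \<in> N" for z z' M
    using Z_orth that by blast
  define approx where "approx = (\<lambda>z (S :: nat \<Rightarrow> ('a \<times> 'a) set). (\<forall>n. orthonormal_pairs (S n) \<and>
      (\<forall>p\<in>S n. factorable_pair N p \<and> fst p \<in> cyclic_span N z \<and> snd p \<in> cyclic_span N z)) \<and>
    (\<forall>M\<in>N. (\<lambda>n. blinfun_apply (pair_isometry (S n)) (blinfun_apply M z)) \<longlonglongrightarrow> blinfun_apply M z))"
  have "\<forall>z\<in>Z. \<exists>S. approx z S"
    unfolding approx_def by (intro ballI homogeneous_vector_approximation[OF N]) (use Z in auto)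
  from bchoice[OF this] obtain S where S: "\<forall>z\<in>Z. approx z (S z)" ..
  have S_orth: "orthonormal_pairs (S z n)" if "z \<in> Z" for z n
    using bspec[OF S that] by (simp add: approx_def)
  have S_pair: "factorable_pair N p \<and> fst p \<in> cyclic_span N z \<and> snd p \<in> cyclic_span N z"
    if "z \<in> Z" "p \<in> S z n" for z n p
    using bspec[OF S that(1)] that(2) by (simp add: approx_def)
  have S_lim: "(\<lambda>n. blinfun_apply (pair_isometry (S z n)) (blinfun_apply M z)) \<longlonglongrightarrow> blinfun_apply M z"
    if "z \<in> Z" "M \<in> N" for z M
    using bspec[OF S that(1)] that(2) by (simp add: approx_def)
  have cyc_orth: "cinner x y = 0"
    if "z \<in> Z" "z' \<in> Z" "z \<noteq> z'" "x \<in> cyclic_span N z" "y \<in> cyclic_span N z'" for x y z z'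
    using that by (intro cyclic_span_orthogonal[OF N orth])
  \<comment> \<open>the second component of an index is the accuracy, the first the part of \<open>Z\<close> that is served\<close>
  define U where "U = (\<lambda>(A, n). \<Union>z\<in>A. S z n)"
  define F where "F = finite_subsets_at_top Z \<times>\<^sub>F sequentially"
  define good where "good = (\<lambda>i :: 'a set \<times> nat. finite (fst i) \<and> fst i \<subseteq> Z)"
  have good_F: "eventually good F"
  proof -
    have "eventually (\<lambda>A. finite A \<and> A \<subseteq> Z) (finite_subsets_at_top Z)"
      by (auto simp: eventually_finite_subsets_at_top)
    then have "eventually (\<lambda>i. finite (fst i) \<and> fst i \<subseteq> Z) F"
      unfolding F_def by (rule eventually_compose_filterlim[OF _ filterlim_fst])
    then show ?thesis
      by (simp add: good_def)
  qed
  have U_orth: "orthonormal_pairs (U i)" if "good i" for i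
  proof -
    obtain A n where i: "i = (A, n)"
      by (cases i)
    have A: "finite A" "A \<subseteq> Z"
      using that by (auto simp: good_def i)
    have "cinner (fst p) (fst q) = 0 \<and> cinner (snd p) (snd q) = 0"
      if p: "z \<in> A" "p \<in> S z n" and q: "z' \<in> A" "q \<in> S z' n" and "p \<noteq> q" for p q z z'
    proof (cases "z = z'")
      case True
      have "orthonormal_pairs (S z n)"
        using S_orth p(1) A by blast
      with p(2) q(2) True \<open>p \<noteq> q\<close> show ?thesis
        unfolding orthonormal_pairs_def by blast
    next
      case False
      have "z \<in> Z" "z' \<in> Z"
        using p(1) q(1) A by blast+
      with False show ?thesis
        using cyc_orth S_pair[OF \<open>z \<in> Z\<close> p(2)] S_pair[OF \<open>z' \<in> Z\<close> q(2)] by blast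
    qed
    moreover have "finite (U i)"
      unfolding U_def i using A S_orth by (auto simp: orthonormal_pairs_def)
    moreover have "norm (fst p) = 1 \<and> norm (snd p) = 1" if "p \<in> U i" for p
      using that A S_orth unfolding U_def i orthonormal_pairs_def by blast
    ultimately show ?thesis
      unfolding orthonormal_pairs_def U_def i by auto
  qed
  define f where "f = (\<lambda>i. pair_isometry (U i))"
  define C where "C = {x. ((\<lambda>i. blinfun_apply (f i) x) \<longlongrightarrow> x) F}"
  have generators: "blinfun_apply M z \<in> C" if M: "M \<in> N" and z: "z \<in> Z" for M z
  proof -
    define g where "g = (\<lambda>n. blinfun_apply (pair_isometry (S z n)) (blinfun_apply M z))"
    have "((\<lambda>i. g (snd i)) \<longlongrightarrow> blinfun_apply M z) F"
      unfolding F_def using S_lim[OF z M] filterlim_snd unfolding g_def by (rule filterlim_compose)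
    moreover have "eventually (\<lambda>i. z \<in> fst i) F"
    proof -
      have "eventually (\<lambda>A. z \<in> A) (finite_subsets_at_top Z)"
        unfolding eventually_finite_subsets_at_top using z by (intro exI[of _ "{z}"]) auto
      then show ?thesis
        unfolding F_def by (rule eventually_compose_filterlim[OF _ filterlim_fst])
    qed
    with good_F have "eventually (\<lambda>i. g (snd i) = blinfun_apply (f i) (blinfun_apply M z)) F"
    proof eventually_elim
      case (elim i)
      obtain A n where i: "i = (A, n)"
        by (cases i)
      have A: "A \<subseteq> Z" "z \<in> A"
        using elim by (auto simp: good_def i)
      have "cinner (blinfun_apply M z) (snd p) *\<^sub>C fst p = 0" if p: "p \<in> U i - S z n" for p
      proof -
        obtain z' where z': "z' \<in> A" "p \<in> S z' n"
          using p unfolding U_def i by auto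
        then have "z \<noteq> z'" "z' \<in> Z"
          using p A by auto
        then have "cinner (blinfun_apply M z) (snd p) = 0"
          using cyc_orth[OF z, of z'] cyclic_span_base[OF M] S_pair[OF _ z'(2)] by blast
        then show ?thesis
          by simp
      qed
      moreover have "S z n \<subseteq> U i" "finite (U i)"
        using A U_orth[OF elim(1)] by (auto simp: U_def i orthonormal_pairs_def)
      ultimately show ?case
        unfolding g_def f_def pair_isometry_apply i snd_conv
        by (intro sum.mono_neutral_left) (auto simp: i)
    qed
    ultimately show ?thesis
      unfolding C_def by (simp add: tendsto_cong)
  qed
  have "csubspace C"
    unfolding C_def f_def by (intro csubspace_pointwise_convergence pair_isometry_clinear)
  moreover have "closed C"
    unfolding C_def using good_F
    by (intro closed_pointwise_convergence) (auto elim!: eventually_mono simp: f_def U_orth norm_pair_isometry_le)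
  ultimately have "closure (cspan {blinfun_apply M z | M z. M \<in> N \<and> z \<in> Z}) \<subseteq> C"
    using generators by (intro closure_minimal cspan_minimal) auto
  then have C: "x \<in> C" for x
    using dense by blast
  have "eventually (\<lambda>i. \<forall>x\<in>L. norm (blinfun_apply (f i) x - x) < 1) F"
  proof (rule eventually_ball_finite[OF L], rule ballI)
    fix x
    show "eventually (\<lambda>i. norm (blinfun_apply (f i) x - x) < 1) F"
      using C[of x] tendstoD[of "\<lambda>i. blinfun_apply (f i) x" x F 1] by (simp add: C_def dist_norm)
  qed
  moreover have "F \<noteq> bot"
    by (simp add: F_def prod_filter_eq_bot)
  ultimately obtain i where i: "good i" "\<forall>x\<in>L. norm (blinfun_apply (f i) x - x) < 1"
    using good_F eventually_happens'[of F "\<lambda>i. good i \<and> (\<forall>x\<in>L. norm (blinfun_apply (f i) x - x) < 1)"]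
    by (auto simp: eventually_conj_iff)
  moreover have "factorable_pair N p" if "p \<in> U i" for p
  proof -
    obtain z where "z \<in> fst i" "p \<in> S z (snd i)"
      using \<open>p \<in> U i\<close> unfolding U_def case_prod_beta by blast
    then show ?thesis
      using i(1) S_pair unfolding good_def by blast
  qed
  ultimately show ?thesis
    using U_orth[OF i(1)] unfolding f_def by blast
qed


section \<open>The strongly convergent net\<close>

lemma limitin_strong_operator_topologyI:
  assumes "\<And>x. ((\<lambda>i. blinfun_apply (f i) x) \<longlongrightarrow> blinfun_apply T x) F"
  shows "limitin strong_operator_topology f T F"
proof -
  have "limitin (product_topology (\<lambda>_. euclidean) UNIV) (\<lambda>i. blinfun_apply (f i)) (blinfun_apply T) F"
    using assms by (simp add: limitin_componentwise)
  then have "((\<lambda>i. blinfun_apply (f i)) \<longlongrightarrow> blinfun_apply T) F"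
    by (simp add: euclidean_product_topology)
  then show ?thesis
    unfolding limitin_def strong_operator_topology_def openin_pullback_topology topspace_pullback_topology
    by (auto dest: topological_tendstoD)
qed

lemma eventually_net_filter:
  assumes "directed_preorder \<Lambda> r"
  shows "eventually P (net_filter \<Lambda> r) \<longleftrightarrow> (\<exists>a\<in>\<Lambda>. \<forall>b\<in>\<Lambda>. (a, b) \<in> r \<longrightarrow> P b)"
proof -
  have tr: "trans r" and ne: "\<Lambda> \<noteq> {}"
    using assms by (auto simp: directed_preorder_def preorder_on_def)
  have "\<exists>x\<in>\<Lambda>. principal {b \<in> \<Lambda>. (x, b) \<in> r}
      \<le> inf (principal {b \<in> \<Lambda>. (a, b) \<in> r}) (principal {b \<in> \<Lambda>. (a', b) \<in> r})"
    if aa': "a \<in> \<Lambda>" "a' \<in> \<Lambda>" for a a'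
  proof -
    obtain c where c: "c \<in> \<Lambda>" "(a, c) \<in> r" "(a', c) \<in> r"
      using assms aa' unfolding directed_preorder_def by blast
    then show ?thesis
      using transD[OF tr c(2)] transD[OF tr c(3)] by (intro bexI[of _ c]) auto
  qed
  then show ?thesis
    unfolding net_filter_def using ne
    by (subst eventually_INF_base) (auto simp: eventually_principal)
qed

text \<open>
  The accuracy attached to a finite set is the constant \<open>1\<close>: by linearity, accuracy \<open>1\<close> at the
  multiple \<open>n *\<^sub>R x\<close> is accuracy \<open>1 / n\<close> at \<open>x\<close>.
\<close>
lemma strong_limit_along_finite_sets:
  fixes f :: "'a::complex_hilbert_space set \<Rightarrow> 'a \<Rightarrow>\<^sub>L 'a"
  assumes dir: "directed_preorder {l. finite l} r"
    and r: "\<And>l m. (l, m) \<in> r \<Longrightarrow> l \<subseteq> m"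
    and near: "\<And>l x. finite l \<Longrightarrow> x \<in> l \<Longrightarrow> norm (blinfun_apply (f l) x - x) < 1"
  shows "limitin strong_operator_topology f id_blinfun (net_filter {l. finite l} r)"
proof (rule limitin_strong_operator_topologyI, unfold id_blinfun.rep_eq id_apply, rule tendstoI)
  fix x :: 'a and e :: real
  assume "e > 0"
  obtain n where n: "1 / real (Suc n) < e"
    using nat_approx_posE[OF \<open>e > 0\<close>] .
  have "dist (blinfun_apply (f l) x) x < e" if l: "finite l" "real (Suc n) *\<^sub>R x \<in> l" for l
  proof -
    have "blinfun_apply (f l) (real (Suc n) *\<^sub>R x) - real (Suc n) *\<^sub>R x
        = real (Suc n) *\<^sub>R (blinfun_apply (f l) x - x)"
      by (simp only: blinfun.scaleR_right scaleR_right_diff_distrib)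
    then have "real (Suc n) * norm (blinfun_apply (f l) x - x) < 1"
      using near[OF l] by (simp only: norm_scaleR abs_of_nat)
    then have "norm (blinfun_apply (f l) x - x) < 1 / real (Suc n)"
      by (simp only: pos_less_divide_eq of_nat_0_less_iff zero_less_Suc mult.commute)
    with n show ?thesis
      by (simp add: dist_norm)
  qed
  then show "eventually (\<lambda>l. dist (blinfun_apply (f l) x) x < e) (net_filter {l. finite l} r)"
    unfolding eventually_net_filter[OF dir]
    by (intro bexI[of _ "{real (Suc n) *\<^sub>R x}"]) (auto dest: r)
qed

theorem theorem2p5:
  fixes \<N>\<^sub>1 :: "('a::complex_hilbert_space \<Rightarrow>\<^sub>L 'a) set"
    and \<N>\<^sub>2 :: "('b::complex_hilbert_space \<Rightarrow>\<^sub>L 'b) set"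
    and \<theta> :: "('a \<Rightarrow>\<^sub>L 'a) \<Rightarrow> ('b \<Rightarrow>\<^sub>L 'b)"
    and X\<^sub>0 :: "('a \<Rightarrow>\<^sub>L 'b) set"
    and Y\<^sub>0 :: "('b \<Rightarrow>\<^sub>L 'a) set"
  assumes "nest \<N>\<^sub>1" and "nest \<N>\<^sub>2" and "nest_isomorphism \<N>\<^sub>1 \<N>\<^sub>2 \<theta>"
    and "X\<^sub>0 = compact_part (Op_nest \<N>\<^sub>1 \<theta>)"
    and "Y\<^sub>0 = compact_part (Op_nest_inv \<N>\<^sub>1 \<theta>)"
  shows "\<exists>(\<Lambda> :: 'a set set) r (f :: 'a set \<Rightarrow> ('a \<Rightarrow>\<^sub>L 'a)).
    directed_preorder \<Lambda> r \<and>
    (\<forall>l\<in>\<Lambda>. f l \<in> clinear_ops \<and> finite_rank (f l) \<and> norm (f l) \<le> 1) \<and>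
    limitin strong_operator_topology f id_blinfun (net_filter \<Lambda> r) \<and>
    (\<forall>l\<in>\<Lambda>. \<exists>(v :: nat \<Rightarrow> nat \<Rightarrow> 'b \<Rightarrow>\<^sub>L 'a) (u :: nat \<Rightarrow> nat \<Rightarrow> 'a \<Rightarrow>\<^sub>L 'b).
      range v \<subseteq> row_ball Y\<^sub>0 \<and> range u \<subseteq> col_ball X\<^sub>0 \<and>
      (\<lambda>i. row_col_prod (v i) (u i)) \<longlonglongrightarrow> f l)"
proof -
  have X0: "0 \<in> X\<^sub>0" and Y0: "0 \<in> Y\<^sub>0"
    unfolding assms(4,5) compact_part_def Op_nest_def Op_nest_inv_def clinear_ops_def compact_operator_def
    by (auto simp: image_constant_conv intro!: blinfun_eqI)
  have "\<forall>l :: 'a set. \<exists>S. finite l \<longrightarrow> orthonormal_pairs S \<and>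
      (\<forall>p\<in>S. factorable_pair \<N>\<^sub>1 p) \<and> (\<forall>x\<in>l. norm (blinfun_apply (pair_isometry S) x - x) < 1)"
    using nest_finite_approximation[OF assms(1)] by blast
  from choice[OF this] obtain S where
    orth: "\<And>l :: 'a set. finite l \<Longrightarrow> orthonormal_pairs (S l)"
    and pairs: "\<And>l p. finite l \<Longrightarrow> p \<in> S l \<Longrightarrow> factorable_pair \<N>\<^sub>1 p"
    and near: "\<And>l x. finite l \<Longrightarrow> x \<in> l \<Longrightarrow> norm (blinfun_apply (pair_isometry (S l)) x - x) < 1"
    by blast
  define \<Lambda> where "\<Lambda> = {l :: 'a set. finite l}"
  define r where "r = {(l, m). finite l \<and> finite m \<and> l \<subseteq> (m :: 'a set)}"
  define f where "f = (\<lambda>l. pair_isometry (S l))"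
  have "directed_preorder \<Lambda> r"
    unfolding directed_preorder_def
  proof (intro conjI ballI)
    show "\<Lambda> \<noteq> {}"
      unfolding \<Lambda>_def by blast
    show "preorder_on \<Lambda> r"
      by (auto simp: preorder_on_def refl_on_def trans_def r_def \<Lambda>_def)
    show "\<exists>c\<in>\<Lambda>. (a, c) \<in> r \<and> (b, c) \<in> r" if "a \<in> \<Lambda>" "b \<in> \<Lambda>" for a b
      using that by (intro bexI[of _ "a \<union> b"]) (auto simp: r_def \<Lambda>_def)
  qed
  moreover have "limitin strong_operator_topology f id_blinfun (net_filter \<Lambda> r)"
    using \<open>directed_preorder \<Lambda> r\<close> near unfolding \<Lambda>_def f_def
    by (intro strong_limit_along_finite_sets) (auto simp: r_def)
  moreover have "f l \<in> clinear_ops \<and> finite_rank (f l) \<and> norm (f l) \<le> 1" if "l \<in> \<Lambda>" for l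
  proof -
    have "orthonormal_pairs (S l)"
      using that orth by (simp add: \<Lambda>_def)
    then show ?thesis
      unfolding f_def
      by (simp add: pair_isometry_clinear finite_rank_pair_isometry norm_pair_isometry_le
          orthonormal_pairs_def)
  qed
  moreover have "\<exists>(v :: nat \<Rightarrow> nat \<Rightarrow> 'b \<Rightarrow>\<^sub>L 'a) (u :: nat \<Rightarrow> nat \<Rightarrow> 'a \<Rightarrow>\<^sub>L 'b).
      range v \<subseteq> row_ball Y\<^sub>0 \<and> range u \<subseteq> col_ball X\<^sub>0 \<and>
      (\<lambda>i. row_col_prod (v i) (u i)) \<longlonglongrightarrow> f l" if "l \<in> \<Lambda>" for l
  proof -
    have l: "finite l"
      using that by (simp add: \<Lambda>_def)
    obtain v u where vu: "v \<in> row_ball Y\<^sub>0" "u \<in> col_ball X\<^sub>0" "row_col_prod v u = f l"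
      using pair_isometry_factorization[OF orth[OF l] X0 Y0] factorable_pair_factors[OF assms(1-3)]
        pairs[OF l] unfolding f_def assms(4,5) by metis
    \<comment> \<open>the factorization is exact, so the sequences can be taken constant\<close>
    then show ?thesis
      by (intro exI[of _ "\<lambda>_. v"] exI[of _ "\<lambda>_. u"]) auto
  qed
  ultimately show ?thesis
    by blast
qed

end
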